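(* Consider the system $x_{t+1}=f(x_t)$, $y_t=\xi_th(x_t)$ with compact state space $X\subseteq\mathbb{R}^N$, where $f$ and $h$ satisfy the assumptions listed in the context and $x_{t+1}=f(x_t)$ has a unique physical measure with all Lyapunov exponents positive. If the error dynamics of $e_t=x_t-\hat x_t$ for the observer $\hat x_{t+1}=f(\hat x_t)+K(y_t)-K(\hat y_t)$, $\hat y_t=\xi_th(\hat x_t)$, is mean square exponentially (MSE) stable, then $$(1-p)^M\left(\prod_{k=1}^N\lambda^k_{exp}\right)^2<1,$$ where $\lambda^k_{exp}=e^{\Lambda^k_{exp}}$ and $\Lambda^k_{exp}$ is the $k$-th positive Lyapunov exponent of $x_{t+1}=f(x_t)$.
   Context: Setting. $x_t\in X\subseteq\mathbb{R}^N$, $f:X\to X$, $h:X\to Y\subseteq\mathbb{R}^M$, with $M<N$. The $\xi_t\in\{0,1\}$, $t\ge 0$, are i.i.d. Bernoulli random variables with $\mathrm{Prob}(\xi_t=1)=p$, $0<p<1$ ($1-p$ is the erasure probability). $E_{\xi_0^t}[\cdot]$ denotes expectation over $\{\xi_0,\dots,\xi_t\}$. A prime denotes transpose; matrix inequalities are in the order of symmetric matrices. Assumptions on the system. $f$ and $h$ are $C^r$, $r\ge1$, with $f(0)=0$, $h(0)=0$, and the Jacobian $\frac{\partial f}{\partial x}(x)$ is uniformly bounded above and below for all $x\in X$ (i.e. $aI_N\le \frac{\partial f}{\partial x}'(x)\frac{\partial f}{\partial x}(x)\le bI_N$ for some constants $a,b>0$). With $\theta^{N-1}(x)=(h(x),h(f(x)),\dots,h(f^{N-1}(x)))'$,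 $\mathrm{rank}\left(\frac{\partial\theta^{N-1}}{\partial x}(x)\right)=N$ and there are $\alpha_\theta,\beta_\theta>0$ with $\alpha_\theta I_N<\frac{\partial\theta^{N-1}}{\partial x}'(x)\frac{\partial\theta^{N-1}}{\partial x}(x)<\beta_\theta I_N$ for all $x\in X$. Assumptions on the observer. $\hat x_t\in X$; the gain $K:Y\to X$ is deterministic, is not an explicit function of $\xi_t$ or its history, is $C^r$ with $r\ge 1$, and $K(0)=0$. Hence the observer reads $\hat x_{t+1}=f(\hat x_t)+\xi_tK(h(x_t))-\xi_tK(h(\hat x_t))$. MSE stability of the error dynamics: there exist positive constants $L<\infty$, $\beta<1$ such that $E_{\xi_0^t}[\|e_{t+1}\|^2]\le L\beta^t\|e_0\|^2$ for all $t\ge0$ and Lebesgue almost all initial conditions ($x_0$ and $e_0$). Physical measure. A Borel probability measure $\mu$ on $X$ is invariant if $\mu(f^{-1}(B))=\mu(B)$ for all Borel $B$; an invariant $\mu$ is ergodic if every bounded continuous $\varphi$ with $\varphi(f(x))=\varphi(x)$ is $\mu$-almost everywhere constant; an ergodic invariant $\mu$ is physical if $\lim_{n\to\infty}\frac1n\sum_{k=0}^n\varphi(f^k(x))=\int_X\varphi\,d\mu$ for a set of initial conditions $x\in X$ of positive Lebesgue measure and all continuous $\varphi:X\to\mathbb{R}$. Lyapunov exponents. Let $\Lambda(x_0)=\lim_{t\to\infty}\left(D_x^tf(x_0)'D_x^tf(x_0)\right)^{\frac1{2t}}$, where $D_xf=\frac{\partial f}{\partial x}$ and $D_x^tf(x_0):=D_xf(x_t)\cdots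 D_xf(x_0)$. If $\lambda^1_{exp}\ge\dots\ge\lambda^N_{exp}$ are the eigenvalues of $\Lambda(x_0)$, the Lyapunov exponents are $\Lambda^i_{exp}=\log\lambda^i_{exp}$. Furthermore, if $\det\Lambda(x_0)\ne0$, then $\lim_{t\to\infty}\frac1t\log|\det D_x^tf(x_0)|=\log\prod_{k=1}^N\lambda^k_{exp}$. The existence of these limits is given by the Multiplicative Ergodic Theorem; the exponents are those associated with the unique physical measure, and under the uniqueness assumption the paper takes the limits to be independent of the initial condition. *)

theory Defs
  imports "HOL-Probability.Probability"
begin

text \<open>
  \<open>Cr_on r f U\<close> is the class \<open>C\<^sup>r\<close> on an open set \<open>U\<close>, with the derivative tested on the standard
  basis. On a set \<open>S\<close> that need not be open, a \<open>C\<^sup>r\<close> map is given together with a \<open>C\<^sup>r\<close> extension to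
  an open neighbourhood of \<open>S\<close>; Jacobians at points of \<open>S\<close> are those of this extension.
\<close>

primrec Cr_on :: "nat \<Rightarrow> ('a::euclidean_space \<Rightarrow> 'b::real_normed_vector) \<Rightarrow> 'a set \<Rightarrow> bool" where
  "Cr_on 0 f U \<longleftrightarrow> continuous_on U f"
| "Cr_on (Suc r) f U \<longleftrightarrow>
     (\<forall>x\<in>U. f differentiable (at x)) \<and>
     (\<forall>b\<in>Basis. Cr_on r (\<lambda>x. frechet_derivative f (at x) b) U)"

definition Cr_near :: "nat \<Rightarrow> ('a::euclidean_space \<Rightarrow> 'b::real_normed_vector) \<Rightarrow> 'a set \<Rightarrow> bool" where
  "Cr_near r f S \<longleftrightarrow> (\<exists>U. open U \<and> S \<subseteq> U \<and> Cr_on r f U)"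


definition psd :: "real^'n^'n \<Rightarrow> bool" where
  "psd A \<longleftrightarrow> transpose A = A \<and> (\<forall>v. 0 \<le> v \<bullet> (A *v v))"

definition posdef :: "real^'n^'n \<Rightarrow> bool" where
  "posdef A \<longleftrightarrow> transpose A = A \<and> (\<forall>v. v \<noteq> 0 \<longrightarrow> 0 < v \<bullet> (A *v v))"

definition loewner_le :: "real^'n^'n \<Rightarrow> real^'n^'n \<Rightarrow> bool" where
  "loewner_le A B \<longleftrightarrow> psd (B - A)"

definition loewner_less :: "real^'n^'n \<Rightarrow> real^'n^'n \<Rightarrow> bool" where
  "loewner_less A B \<longleftrightarrow> posdef (B - A)"

text \<open>The library operation \<open>^\<close> on this type is componentwise, so matrix powers are iterated products.\<close>

definition matpow :: "real^'n^'n \<Rightarrow> nat \<Rightarrow> real^'n^'n" where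
  "matpow A k = (((**) A) ^^ k) (mat 1)"

text \<open>\<open>lam 1 \<ge> \<dots> \<ge> lam N\<close> are the eigenvalues of the matrix, repeated according to multiplicity.\<close>

definition ordered_eigenvalues :: "real^'n^'n \<Rightarrow> (nat \<Rightarrow> real) \<Rightarrow> bool" where
  "ordered_eigenvalues A lam \<longleftrightarrow>
     (\<forall>i j. 1 \<le> i \<and> i \<le> j \<and> j \<le> CARD('n) \<longrightarrow> lam j \<le> lam i) \<and>
     (\<forall>s. det (mat s - A) = (\<Prod>k=1..CARD('n). s - lam k))"


text \<open>
  The stacked map \<open>x \<mapsto> (h x, h (f x), \<dots>, h (f\<^sup>N\<^sup>-\<^sup>1 x))\<close>. Its values are indexed by pairs (block,
  component); \<open>to_nat_on UNIV\<close> is a bijection from the \<open>N\<close>-element index type onto \<open>{..<N}\<close>. A different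
  bijection would only permute the rows of the Jacobian, which changes neither its rank nor
  the product of its transpose with itself.
\<close>

definition obs_map ::
  "(real^'n \<Rightarrow> real^'n) \<Rightarrow> (real^'n \<Rightarrow> real^'m) \<Rightarrow> real^'n \<Rightarrow> real^('n \<times> 'm)" where
  "obs_map f h x = (\<chi> q. h ((f ^^ to_nat_on (UNIV::'n set) (fst q)) x) $ snd q)"

definition system_assms ::
  "nat \<Rightarrow> (real^'n) set \<Rightarrow> (real^'m) set \<Rightarrow> (real^'n \<Rightarrow> real^'n) \<Rightarrow> (real^'n \<Rightarrow> real^'m) \<Rightarrow> bool" where
  "system_assms r X Y f h \<longleftrightarrow>
     f ` X \<subseteq> X \<and> h ` X \<subseteq> Y \<and> Cr_near r f X \<and> Cr_near r h X \<and>
     0 \<in> X \<and> f 0 = 0 \<and> h 0 = 0 \<and>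
     (\<exists>a b. 0 < a \<and> 0 < b \<and>
        (\<forall>x\<in>X. let J = jacobian f (at x) in
           loewner_le (mat a) (transpose J ** J) \<and> loewner_le (transpose J ** J) (mat b))) \<and>
     (\<forall>x\<in>X. rank (jacobian (obs_map f h) (at x)) = CARD('n)) \<and>
     (\<exists>\<alpha> \<beta>. 0 < \<alpha> \<and> 0 < \<beta> \<and>
        (\<forall>x\<in>X. let J = jacobian (obs_map f h) (at x) in
           loewner_less (mat \<alpha>) (transpose J ** J) \<and> loewner_less (transpose J ** J) (mat \<beta>)))"


text \<open>The observer state, for a realisation \<open>s\<close> of the erasure sequence (\<open>True\<close> stands for 1).\<close>

primrec observer ::
  "(real^'n \<Rightarrow> real^'n) \<Rightarrow> (real^'n \<Rightarrow> real^'m) \<Rightarrow> (real^'m \<Rightarrow> real^'n) \<Rightarrow> (nat \<Rightarrow> bool) \<Rightarrow>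
   real^'n \<Rightarrow> real^'n \<Rightarrow> nat \<Rightarrow> real^'n" where
  "observer f h K s x0 z0 0 = z0"
| "observer f h K s x0 z0 (Suc t) =
     f (observer f h K s x0 z0 t)
     + K (of_bool (s t) *\<^sub>R h ((f ^^ t) x0))
     - K (of_bool (s t) *\<^sub>R h (observer f h K s x0 z0 t))"

definition observer_assms ::
  "nat \<Rightarrow> (real^'n) set \<Rightarrow> (real^'m) set \<Rightarrow> (real^'n \<Rightarrow> real^'n) \<Rightarrow> (real^'n \<Rightarrow> real^'m) \<Rightarrow>
   (real^'m \<Rightarrow> real^'n) \<Rightarrow> bool" where
  "observer_assms r X Y f h K \<longleftrightarrow>
     K ` Y \<subseteq> X \<and> Cr_near r K Y \<and> K 0 = 0 \<and>
     (\<forall>s. \<forall>x0\<in>X. \<forall>z0\<in>X. \<forall>t. observer f h K s x0 z0 t \<in> X)"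

definition obs_error ::
  "(real^'n \<Rightarrow> real^'n) \<Rightarrow> (real^'n \<Rightarrow> real^'m) \<Rightarrow> (real^'m \<Rightarrow> real^'n) \<Rightarrow> (nat \<Rightarrow> bool) \<Rightarrow>
   real^'n \<Rightarrow> real^'n \<Rightarrow> nat \<Rightarrow> real^'n" where
  "obs_error f h K s x0 e0 t = (f ^^ t) x0 - observer f h K s x0 (x0 - e0) t"

definition iid_bernoulli :: "'w measure \<Rightarrow> (nat \<Rightarrow> 'w \<Rightarrow> bool) \<Rightarrow> real \<Rightarrow> bool" where
  "iid_bernoulli P \<xi> p \<longleftrightarrow>
     prob_space P \<and>
     prob_space.indep_vars P (\<lambda>_. count_space UNIV) \<xi> UNIV \<and>
     (\<forall>t. distr P (count_space UNIV) (\<xi> t) = measure_pmf (bernoulli_pmf p))"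

text \<open>
  \<open>obs_error \<dots> (Suc t)\<close> depends on the random variables \<open>\<xi> 0, \<dots>, \<xi> t\<close> only, so the expectation over
  these variables is the expectation under \<open>P\<close>. Almost all initial conditions are meant with
  respect to Lebesgue measure on pairs \<open>(x0, e0)\<close>.
\<close>

definition mse_stable ::
  "(real^'n) set \<Rightarrow> (real^'n \<Rightarrow> real^'n) \<Rightarrow> (real^'n \<Rightarrow> real^'m) \<Rightarrow> (real^'m \<Rightarrow> real^'n) \<Rightarrow>
   'w measure \<Rightarrow> (nat \<Rightarrow> 'w \<Rightarrow> bool) \<Rightarrow> bool" where
  "mse_stable X f h K P \<xi> \<longleftrightarrow>
     (\<exists>L \<beta>. 0 < L \<and> 0 < \<beta> \<and> \<beta> < 1 \<and>
       (AE (x0, e0) in (lborel :: ((real^'n) \<times> (real^'n)) measure).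
          x0 \<in> X \<and> x0 - e0 \<in> X \<longrightarrow>
          (\<forall>t. (\<integral>\<omega>. (norm (obs_error f h K (\<lambda>k. \<xi> k \<omega>) x0 e0 (Suc t)))\<^sup>2 \<partial>P)
                \<le> L * \<beta> ^ t * (norm e0)\<^sup>2)))"


definition invariant_measure :: "(real^'n) set \<Rightarrow> (real^'n \<Rightarrow> real^'n) \<Rightarrow> (real^'n) measure \<Rightarrow> bool" where
  "invariant_measure X f \<mu> \<longleftrightarrow>
     prob_space \<mu> \<and> sets \<mu> = sets (restrict_space borel X) \<and>
     (\<forall>B\<in>sets \<mu>. measure \<mu> (f -` B \<inter> X) = measure \<mu> B)"

definition ergodic_measure :: "(real^'n) set \<Rightarrow> (real^'n \<Rightarrow> real^'n) \<Rightarrow> (real^'n) measure \<Rightarrow> bool" where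
  "ergodic_measure X f \<mu> \<longleftrightarrow>
     invariant_measure X f \<mu> \<and>
     (\<forall>\<phi>::real^'n \<Rightarrow> real. continuous_on X \<phi> \<and> bounded (\<phi> ` X) \<and> (\<forall>x\<in>X. \<phi> (f x) = \<phi> x)
        \<longrightarrow> (\<exists>c. AE x in \<mu>. \<phi> x = c))"

definition physical_measure :: "(real^'n) set \<Rightarrow> (real^'n \<Rightarrow> real^'n) \<Rightarrow> (real^'n) measure \<Rightarrow> bool" where
  "physical_measure X f \<mu> \<longleftrightarrow>
     ergodic_measure X f \<mu> \<and>
     (\<exists>S. S \<subseteq> X \<and> S \<in> sets lebesgue \<and> 0 < emeasure lebesgue S \<and>
        (\<forall>x\<in>S. \<forall>\<phi>::real^'n \<Rightarrow> real. continuous_on X \<phi> \<longrightarrow>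
           (\<lambda>n. (1 / real n) * (\<Sum>k=0..n. \<phi> ((f ^^ k) x))) \<longlonglongrightarrow> (\<integral>x. \<phi> x \<partial>\<mu>)))"


text \<open>\<open>deriv_cocycle f x t\<close> is \<open>Df(x\<^sub>t) \<cdots> Df(x\<^sub>0)\<close> with \<open>x\<^sub>k = f\<^sup>k x\<close>; it has \<open>t + 1\<close> factors.\<close>

primrec deriv_cocycle :: "(real^'n \<Rightarrow> real^'n) \<Rightarrow> real^'n \<Rightarrow> nat \<Rightarrow> real^'n^'n" where
  "deriv_cocycle f x 0 = jacobian f (at x)"
| "deriv_cocycle f x (Suc t) = jacobian f (at ((f ^^ Suc t) x)) ** deriv_cocycle f x t"

text \<open>
  \<open>R t\<close> is the matrix power of \<open>D' D\<close>, \<open>D = deriv_cocycle f x t\<close>, with exponent \<open>1 / (2 t)\<close>: the unique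
  positive semidefinite \<open>2 t\<close>-th root.
\<close>

definition lyapunov_limit :: "(real^'n \<Rightarrow> real^'n) \<Rightarrow> real^'n \<Rightarrow> real^'n^'n \<Rightarrow> bool" where
  "lyapunov_limit f x Lam \<longleftrightarrow>
     (\<exists>R. (\<forall>t\<ge>1. psd (R t) \<and>
             matpow (R t) (2 * t) = transpose (deriv_cocycle f x t) ** deriv_cocycle f x t) \<and>
          R \<longlonglongrightarrow> Lam)"

text \<open>
  For \<open>\<mu>\<close>-almost every initial condition the limit exists, with the same ordered eigenvalues
  \<open>lam 1, \<dots>, lam N\<close>; the Lyapunov exponents of \<open>\<mu>\<close> are their logarithms.
\<close>

definition exp_lyapunov_exponents ::
  "(real^'n \<Rightarrow> real^'n) \<Rightarrow> (real^'n) measure \<Rightarrow> (nat \<Rightarrow> real) \<Rightarrow> bool" where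
  "exp_lyapunov_exponents f \<mu> lam \<longleftrightarrow>
     (AE x in \<mu>. \<exists>Lam. lyapunov_limit f x Lam \<and> ordered_eigenvalues Lam lam)"

end

theory Submission
  imports Defs
begin

text \<open>
  Suppose the observer starts at \<open>x + \<epsilon> v\<close> for a small \<open>\<epsilon>\<close>. To first order the error evolves by a random
  product of matrices: with probability \<open>1 - p\<close> the factor is \<open>A\<close>, the Jacobian of \<open>f\<close> along the orbit of
  \<open>x\<close>, and with probability \<open>p\<close> it is \<open>A - B\<close>, where \<open>B\<close> is the Jacobian of \<open>K \<circ> h\<close>. Let \<open>q t x v\<close> be the
  expected squared length of the product of \<open>t\<close> factors applied to \<open>v\<close>. This is a quadratic form in
  \<open>v\<close>, and conditioning on the first factor gives
  \<open>q (t + 1) x v = (1 - p) q t (f x) (A v) + p q t (f x) ((A - B) v)\<close>.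

  The theorem comes from comparing two bounds for the determinant of this form. From above: mean
  square stability makes \<open>q\<close> of order \<open>\<beta>\<^sup>t\<close> at most, hence its determinant of order \<open>\<beta>\<close> to the power
  \<open>N t\<close> at most (\<open>AE_second_moment_le\<close>, \<open>abs_det_le_columns\<close>). From below: \<open>B\<close> vanishes on the kernel of the
  Jacobian of \<open>h\<close>, which has codimension at most \<open>M\<close>, and on this kernel the two terms of the recursion
  come from the same map \<open>A\<close>. So a step multiplies the determinant by at least \<open>(1 - p)\<^sup>M (det A)\<^sup>2\<close>
  (\<open>det_mixture\<close>, \<open>second_moment_gram\<close>). Taking logarithms and dividing by \<open>t\<close>, the number
  \<open>M ln (1 - p)\<close> plus twice the limiting average of \<open>ln \<bar>det A\<bar>\<close> along the orbit is at most
  \<open>N ln \<beta> < 0\<close>.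

  It remains to identify this average with \<open>ln (\<Prod>k. lam k)\<close>. The point \<open>x\<close> has to be typical for Lebesgue
  measure, because stability is only known for such initial states; the Lyapunov exponents are only
  known at typical points of \<open>\<mu>\<close>, which may be singular. The physical measure links the two. The function
  \<open>ln \<bar>det A\<bar>\<close> is continuous on \<open>X\<close>, so its averages along orbits in the basin of \<open>\<mu>\<close>, a set of positive
  Lebesgue measure, converge to its integral. By invariance and dominated convergence this integral
  is also the limit of the averages at \<open>\<mu>\<close>-almost every point, which by the definition of the exponents
  is \<open>ln (\<Prod>k. lam k)\<close> (\<open>tendsto_ln_det_average\<close>, \<open>integral_eq_of_birkhoff_limit\<close>).

  Stability is assumed almost everywhere on a compact set that may have empty interior, so it is not
  obvious that it can be linearized. This is overcome by passing to the support of Lebesgue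
  measure on \<open>X\<close> and by the continuity of measure under translations
  (\<open>AE_pair_good_support\<close>, \<open>negligible_no_return_in_direction\<close>).
\<close>

section \<open>Determinants of sums of Gram matrices\<close>

text \<open>
  A crude form of Hadamard's inequality, read off from the Leibniz formula: every entry is bounded
  by the length of its column. The factor \<open>N!\<close> does no harm, because the lemma is only used where a
  constant factor disappears: under \<open>k\<close>-th roots, and in exponential growth rates.
\<close>

lemma abs_det_le_columns:
  fixes G :: "real^'n^'n"
  assumes "\<And>j. norm (G *v axis j 1) \<le> c"
  shows "\<bar>det G\<bar> \<le> fact (CARD('n)) * c ^ CARD('n)"
proof -
  have entry: "\<bar>G $ i $ j\<bar> \<le> c" for i j
    using component_le_norm_cart[of "G *v axis j 1" i] assms[of j]
    by (simp add: matrix_vector_mult_basis column_def)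
  have "\<bar>det G\<bar> \<le> (\<Sum>\<pi> | \<pi> permutes (UNIV::'n set). \<Prod>i\<in>UNIV. \<bar>G $ i $ \<pi> i\<bar>)"
    unfolding det_def
    by (rule order_trans[OF sum_abs], rule sum_mono) (simp add: abs_mult abs_prod sign_def)
  also have "\<dots> \<le> (\<Sum>\<pi> | \<pi> permutes (UNIV::'n set). \<Prod>i\<in>(UNIV::'n set). c)"
    by (intro sum_mono prod_mono) (simp add: entry)
  also have "\<dots> = fact (CARD('n)) * c ^ CARD('n)"
    by (simp add: card_permutations)
  finally show ?thesis .
qed

text \<open>
  All powers of \<open>T\<close> are contractions as well, so \<open>\<bar>det T\<bar>\<^sup>k \<le> N!\<close> for every \<open>k\<close>.
\<close>

lemma abs_det_contraction:
  fixes T :: "real^'n^'n"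
  assumes T: "\<And>v. norm (T *v v) \<le> norm v"
  shows "\<bar>det T\<bar> \<le> 1"
proof (rule ccontr)
  assume "\<not> \<bar>det T\<bar> \<le> 1"
  then obtain k where k: "fact CARD('n) < \<bar>det T\<bar> ^ k"
    using real_arch_pow[of "\<bar>det T\<bar>" "fact CARD('n)"] by auto
  have "\<exists>M::real^'n^'n. det M = det T ^ k \<and> (\<forall>v. norm (M *v v) \<le> norm v)"
  proof (induction k)
    case 0
    show ?case by (rule exI[of _ "mat 1"]) simp
  next
    case (Suc k)
    then obtain M :: "real^'n^'n" where "det M = det T ^ k" "\<And>v. norm (M *v v) \<le> norm v" by auto
    then show ?case
      by (intro exI[of _ "T ** M"])
        (auto simp: det_mul matrix_vector_mul_assoc[symmetric] intro: order_trans[OF T])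
  qed
  then obtain M :: "real^'n^'n" where M: "det M = det T ^ k" "\<And>v. norm (M *v v) \<le> norm v" by auto
  have "\<bar>det M\<bar> \<le> fact CARD('n) * 1 ^ CARD('n)"
    by (rule abs_det_le_columns) (use M(2)[of "axis _ 1"] in simp)
  with k M(1) show False by (simp add: power_abs)
qed

text \<open>
  The Loewner monotonicity of the determinant of \<open>E' E \<le> H' H\<close>, stated for the
  factors: if \<open>H\<close> is invertible then \<open>E\<close> composed with the inverse of \<open>H\<close> is a contraction.
\<close>

lemma abs_det_mono:
  fixes E H :: "real^'n^'n"
  assumes le: "\<And>v. norm (E *v v) \<le> norm (H *v v)"
  shows "\<bar>det E\<bar> \<le> \<bar>det H\<bar>"
proof (cases "det H = 0")
  case True
  then have "\<not> invertible H"
    by (simp add: invertible_det_nz)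
  then obtain v where "v \<noteq> 0" "H *v v = 0"
    by (auto simp: invertible_left_inverse matrix_left_invertible_ker)
  with le[of v] have "E *v v = 0" by simp
  with \<open>v \<noteq> 0\<close> have "\<not> invertible E"
    by (auto simp: invertible_left_inverse matrix_left_invertible_ker)
  then show ?thesis
    by (simp add: invertible_det_nz)
next
  case False
  then obtain R where R: "H ** R = mat 1"
    by (metis invertible_det_nz invertible_def)
  let ?T = "E ** R"
  have T1: "\<bar>det ?T\<bar> \<le> 1"
  proof (rule abs_det_contraction)
    show "norm (?T *v w) \<le> norm w" for w
      using le[of "R *v w"] R by (simp add: matrix_vector_mul_assoc)
  qed
  have "det R * det H = 1"
    using arg_cong[OF R, of det] by (simp add: det_mul mult.commute)
  then have "\<bar>det E\<bar> = \<bar>det ?T\<bar> * \<bar>det H\<bar>"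
    by (simp add: det_mul abs_mult[symmetric] mult.assoc)
  also have "\<dots> \<le> 1 * \<bar>det H\<bar>"
    by (intro mult_right_mono T1) simp
  finally show ?thesis by simp
qed

text \<open>
  \<open>S\<close> is the identity plus a block that maps the coordinates outside \<open>I\<close> into those in \<open>I\<close>. Reflecting
  the coordinates outside \<open>I\<close> conjugates \<open>S\<close> to its inverse, so \<open>det S\<close> equals its
  own inverse.
\<close>

lemma abs_det_block_shear:
  fixes S :: "real^'n^'n" and I :: "'n set"
  assumes diag: "\<And>i. S $ i $ i = 1"
    and off: "\<And>i j. i \<noteq> j \<Longrightarrow> \<not> (i \<in> I \<and> j \<notin> I) \<Longrightarrow> S $ i $ j = 0"
  shows "\<bar>det S\<bar> = 1"
proof -
  let ?s = "\<lambda>i. if i \<in> I then 1 else - 1 :: real"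
  define J where "J = ((\<chi> i j. if i = j then ?s i else 0) :: real^'n^'n)"
  define S' where "S' = ((\<chi> i j. ?s i * S $ i $ j * ?s j) :: real^'n^'n)"
  have JSJ: "J ** S ** J = S'"
    unfolding J_def S'_def matrix_matrix_mult_def
    by (simp add: vec_eq_iff if_distrib[of "\<lambda>x. x * _"] if_distrib[of "\<lambda>x. _ * x"] cong: if_cong)
  have detJ: "\<bar>det J\<bar> = 1"
    by (subst det_diagonal) (auto simp: J_def abs_prod intro!: prod.neutral)
  have "(S ** S') $ i $ j = mat 1 $ i $ j" for i j
  proof -
    have "(S ** S') $ i $ j = (\<Sum>k\<in>UNIV. S $ i $ k * (?s k * S $ k $ j * ?s j))"
      by (simp add: matrix_matrix_mult_def S'_def)
    also have "\<dots> = (\<Sum>k\<in>{i, j}. S $ i $ k * (?s k * S $ k $ j * ?s j))"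
      proof (rule sum.mono_neutral_right)
      show "\<forall>k\<in>UNIV - {i, j}. S $ i $ k * (?s k * S $ k $ j * ?s j) = 0"
        using off by (metis DiffE insertCI mult_eq_0_iff)
    qed auto
    also have "\<dots> = mat 1 $ i $ j"
      using diag off[of i j] by (cases "i = j") (auto simp: mat_def)
    finally show ?thesis .
  qed
  then have "S ** S' = mat 1" by (simp add: vec_eq_iff)
  then have "det S * det S' = 1" by (metis det_I det_mul)
  moreover have "\<bar>det S'\<bar> = \<bar>det S\<bar>"
    using detJ by (simp add: JSJ[symmetric] det_mul abs_mult)
  ultimately have "\<bar>det S\<bar> * \<bar>det S\<bar> = 1"
    by (metis abs_mult abs_one)
  then show ?thesis
    by (metis abs_mult_self_eq abs_of_nonneg abs_ge_zero mult_cancel_left1 real_sqrt_abs2 real_sqrt_one)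
qed

text \<open>
  The heart of the matter, in suitable coordinates. If \<open>v = w + u\<close> with \<open>w\<close> supported on \<open>I\<close> and \<open>u\<close> off
  \<open>I\<close>, then the \<open>I\<close>-part of \<open>Q v\<close> is \<open>w + a\<close> with \<open>a\<close> depending linearly on \<open>u\<close>, and convexity gives
  \<open>(1 - p) |w|\<^sup>2 + p |w + a|\<^sup>2 \<ge> |w + p a|\<^sup>2\<close>. So \<open>H\<close> dominates the map \<open>v \<mapsto> (w + p a) + sqrt (1 - p) u\<close>,
  which is a shear \<open>S\<close> followed by a diagonal matrix \<open>D\<close> that shrinks only the directions off \<open>I\<close>.
\<close>

lemma det_mixture_coordinate:
  fixes H Q :: "real^'n^'n" and I :: "'n set"
  assumes p: "0 \<le> p" "p \<le> 1"
    and fixI: "\<And>i. i \<in> I \<Longrightarrow> Q *v axis i 1 = axis i 1"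
    and H: "\<And>v. (norm (H *v v))\<^sup>2 = (1 - p) * (norm v)\<^sup>2 + p * (norm (Q *v v))\<^sup>2"
  shows "sqrt (1 - p) ^ card (- I) \<le> \<bar>det H\<bar>"
proof -
  define D :: "real^'n^'n" where "D = (\<chi> i j. if i = j then (if i \<in> I then 1 else sqrt (1 - p)) else 0)"
  define S :: "real^'n^'n" where
    "S = (\<chi> i j. if i = j then 1 else if i \<in> I \<and> j \<notin> I then p * Q $ i $ j else 0)"
  have Qcol: "Q $ j $ i = (if j = i then 1 else 0)" if "i \<in> I" for i j
    using fixI[OF that] by (simp add: matrix_vector_mul_component vec_eq_iff axis_def inner_axis inner_vec_def
      if_distrib cong: if_cong)
  have "norm ((D ** S) *v v) \<le> norm (H *v v)" for v
  proof -
    define a where "a i = (\<Sum>j\<in>-I. Q $ i $ j * v $ j)" for i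
    have Qv: "(Q *v v) $ i = v $ i + a i" if "i \<in> I" for i
    proof -
      have "(Q *v v) $ i = (\<Sum>j\<in>I. Q $ i $ j * v $ j) + (\<Sum>j\<in>-I. Q $ i $ j * v $ j)"
        unfolding matrix_vector_mult_def by (simp add: Compl_eq_Diff_UNIV sum.subset_diff[of I UNIV] add.commute)
      also have "(\<Sum>j\<in>I. Q $ i $ j * v $ j) = v $ i"
        using that by (simp add: Qcol if_distrib[of "\<lambda>x. x * _"] cong: if_cong)
      finally show ?thesis by (simp add: a_def)
    qed
    have Sv: "(S *v v) $ i = (if i \<in> I then v $ i + p * a i else v $ i)" for i
    proof -
      have "(S *v v) $ i = (\<Sum>j\<in>UNIV. (if i = j then v $ j else 0) +
          (if j \<in> - I then (if i \<in> I then p * Q $ i $ j * v $ j else 0) else 0))"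
        unfolding matrix_vector_mult_def by (auto simp: S_def intro!: sum.cong)
      also have "\<dots> = v $ i + (\<Sum>j\<in>-I. if i \<in> I then p * Q $ i $ j * v $ j else 0)"
        by (simp only: sum.distrib sum.inter_restrict[symmetric] finite) simp
      finally show ?thesis by (simp add: a_def sum_distrib_left mult.assoc)
    qed
    have Dw: "(D *v w) $ i = (if i \<in> I then w $ i else sqrt (1 - p) * w $ i)" for i w
      unfolding matrix_vector_mult_def
      by (simp add: D_def if_distrib[of "\<lambda>x. x * _"] cong: if_cong)
    have sq: "(norm w)\<^sup>2 = (\<Sum>i\<in>I. (w $ i)\<^sup>2) + (\<Sum>i\<in>-I. (w $ i)\<^sup>2)" for w :: "real^'n"
      by (simp add: norm_eq_sqrt_inner inner_vec_def power2_eq_square[symmetric] sum_nonneg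
        Compl_eq_Diff_UNIV sum.subset_diff[of I UNIV] add.commute)
    have "(norm ((D ** S) *v v))\<^sup>2 = (\<Sum>i\<in>I. (v $ i + p * a i)\<^sup>2) + (1 - p) * (\<Sum>i\<in>-I. (v $ i)\<^sup>2)"
      using p by (simp add: matrix_vector_mul_assoc[symmetric] sq Dw Sv power_mult_distrib sum_distrib_left)
    also have "(\<Sum>i\<in>I. (v $ i + p * a i)\<^sup>2) \<le> (\<Sum>i\<in>I. (1 - p) * (v $ i)\<^sup>2 + p * ((Q *v v) $ i)\<^sup>2)"
    proof (rule sum_mono)
      fix i assume "i \<in> I"
      have "(1 - p) * (v $ i)\<^sup>2 + p * (v $ i + a i)\<^sup>2 - (v $ i + p * a i)\<^sup>2 = p * (1 - p) * (a i)\<^sup>2"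
        by (simp add: power2_eq_square algebra_simps)
      moreover have "0 \<le> p * (1 - p) * (a i)\<^sup>2" using p by simp
      ultimately show "(v $ i + p * a i)\<^sup>2 \<le> (1 - p) * (v $ i)\<^sup>2 + p * ((Q *v v) $ i)\<^sup>2"
        using Qv[OF \<open>i \<in> I\<close>] by simp
    qed
    also have "(\<Sum>i\<in>I. (1 - p) * (v $ i)\<^sup>2 + p * ((Q *v v) $ i)\<^sup>2) + (1 - p) * (\<Sum>i\<in>-I. (v $ i)\<^sup>2)
        \<le> (1 - p) * (norm v)\<^sup>2 + p * (norm (Q *v v))\<^sup>2"
      using p by (simp add: sq sum.distrib sum_distrib_left[symmetric] distrib_left sum_nonneg)
    finally have "(norm ((D ** S) *v v))\<^sup>2 \<le> (norm (H *v v))\<^sup>2" by (simp add: H)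
    then show ?thesis by (rule power2_le_imp_le) simp
  qed
  then have "\<bar>det (D ** S)\<bar> \<le> \<bar>det H\<bar>" by (rule abs_det_mono)
  moreover have "\<bar>det S\<bar> = 1"
    by (rule abs_det_block_shear[of _ I]) (auto simp: S_def)
  moreover have "det D = sqrt (1 - p) ^ card (- I)"
  proof -
    have "det D = (\<Prod>i\<in>UNIV. if i \<in> I then 1 else sqrt (1 - p))"
      by (subst det_diagonal) (auto simp: D_def)
    also have "\<dots> = (\<Prod>i\<in>-I. sqrt (1 - p))"
      by (intro prod.mono_neutral_cong_right) auto
    finally show ?thesis by simp
  qed
  ultimately show ?thesis
    using p by (simp add: det_mul abs_mult)
qed

text \<open>
  The columns of \<open>U\<close> are orthonormal bases of \<open>W\<close> and of its orthogonal complement put together.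
\<close>

lemma orthogonal_matrix_adapted:
  fixes W :: "(real^'n) set"
  assumes "subspace W"
  obtains U :: "real^'n^'n" and I where "orthogonal_matrix U" "card I = dim W"
    "\<And>i. i \<in> I \<Longrightarrow> U *v axis i 1 \<in> W"
proof -
  obtain B where B: "B \<subseteq> W" "pairwise orthogonal B" "\<And>x. x \<in> B \<Longrightarrow> norm x = 1"
      "independent B" "card B = dim W" "span B = W"
    using orthonormal_basis_subspace[OF assms] by metis
  define V where "V = {y. \<forall>x\<in>W. orthogonal x y}"
  have "subspace V" unfolding V_def by (rule subspace_orthogonal_to_vectors)
  then obtain C where C: "C \<subseteq> V" "pairwise orthogonal C" "\<And>x. x \<in> C \<Longrightarrow> norm x = 1"
      "independent C" "card C = dim V" "span C = V"
    using orthonormal_basis_subspace by metis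
  have dims: "dim V + dim W = CARD('n)"
    using dim_subspace_orthogonal_to_vectors[OF assms subspace_UNIV] by (simp add: V_def)
  have fin: "finite B" "finite C" using B(4) C(4) independent_imp_finite by auto
  have disj: "B \<inter> C = {}"
  proof (rule ccontr)
    assume "B \<inter> C \<noteq> {}"
    then obtain x where x: "x \<in> B" "x \<in> C" by auto
    then have "orthogonal x x" using B(1) C(1) by (auto simp: V_def)
    then show False using B(3)[OF x(1)] by (simp add: orthogonal_self)
  qed
  have "card (B \<union> C) = CARD('n)"
    using fin disj dims B(5) C(5) by (simp add: card_Un_disjoint)
  then obtain \<phi> where \<phi>: "bij_betw \<phi> (UNIV::'n set) (B \<union> C)"
    using fin by (metis finite_UnI finite_same_card_bij finite_class.finite_UNIV)
  define U :: "real^'n^'n" where "U = (\<chi> i j. \<phi> j $ i)"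
  have col: "column j U = \<phi> j" for j by (simp add: column_def U_def vec_eq_iff)
  have in_BC: "\<phi> i \<in> B \<union> C" for i using \<phi> by (auto simp: bij_betw_def)
  have "pairwise orthogonal (B \<union> C)"
    using B(1,2) C(1,2) unfolding pairwise_def V_def by (metis (mono_tags, lifting) UnE mem_Collect_eq orthogonal_commute subsetD)
  moreover have "\<phi> i \<noteq> \<phi> j" if "i \<noteq> j" for i j
    using \<phi> that by (auto simp: bij_betw_def inj_def)
  ultimately have "orthogonal_matrix U"
    unfolding orthogonal_matrix_orthonormal_columns col
    using in_BC B(3) C(3) by (auto simp: pairwise_def) (metis UnE)+
  moreover have "card (\<phi> -` B) = dim W"
  proof -
    have "card (\<phi> -` B) = card (\<phi> ` (\<phi> -` B))"
      using \<phi> by (intro card_image[symmetric]) (auto simp: bij_betw_def inj_on_def)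
    also have "\<phi> ` (\<phi> -` B) = B" using \<phi> by (auto simp: bij_betw_def)
    finally show ?thesis using B(5) by simp
  qed
  moreover have "U *v axis i 1 \<in> W" if "i \<in> \<phi> -` B" for i
    using that B(1) by (auto simp: matrix_vector_mult_basis col)
  ultimately show ?thesis using that by blast
qed

text \<open>
  Mixing a second quadratic form into \<open>|P v|\<^sup>2\<close> with weight \<open>p\<close> costs a factor \<open>sqrt (1 - p)\<close> in the
  determinant only for the directions outside the subspace on which both forms come from the same
  map. Composing with the inverse of \<open>P\<close> and a rotation reduces this to the case \<open>P = 1\<close>
  with a coordinate subspace.
\<close>

lemma det_mixture:
  fixes H P Q :: "real^'n^'n"
  assumes p: "0 \<le> p" "p \<le> 1" and W: "subspace W"
    and agree: "\<And>v. v \<in> W \<Longrightarrow> Q *v v = P *v v"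
    and H: "\<And>v. (norm (H *v v))\<^sup>2 = (1 - p) * (norm (P *v v))\<^sup>2 + p * (norm (Q *v v))\<^sup>2"
  shows "sqrt (1 - p) ^ (CARD('n) - dim W) * \<bar>det P\<bar> \<le> \<bar>det H\<bar>"
proof (cases "det P = 0")
  case False
  then obtain R where R: "P ** R = mat 1" "R ** P = mat 1"
    by (metis invertible_det_nz invertible_def)
  have lin: "linear ((*v) P)" by simp
  have inj: "inj ((*v) P)"
    using R(2) by (metis inj_def matrix_vector_mul_assoc matrix_vector_mul_lid)
  have "dim (((*v) P) ` W) = dim W"
    by (rule dim_image_eq[OF lin]) (use inj in \<open>auto intro: inj_on_subset\<close>)
  moreover obtain U :: "real^'n^'n" and I where U: "orthogonal_matrix U"
      "card I = dim (((*v) P) ` W)" "\<And>i. i \<in> I \<Longrightarrow> U *v axis i 1 \<in> ((*v) P) ` W"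
    using orthogonal_matrix_adapted[OF linear_subspace_image[OF lin W]] by metis
  ultimately have cI: "card (- I) = CARD('n) - dim W"
    by (simp add: Compl_eq_Diff_UNIV card_Diff_subset)
  have normU: "norm (U *v v) = norm v" for v
    using U(1) by (simp add: orthogonal_transformation_matrix orthogonal_transformation_norm)
  have normU': "norm (transpose U *v v) = norm v" for v
    using orthogonal_matrix_transpose[of U] U(1)
    by (simp add: orthogonal_transformation_matrix[of "(*v) (transpose U)"] orthogonal_transformation_norm del: vector_transpose_matrix transpose_matrix_vector)
  let ?H = "H ** (R ** U)" and ?Q = "transpose U ** (Q ** (R ** U))"
  have "sqrt (1 - p) ^ card (- I) \<le> \<bar>det ?H\<bar>"
  proof (rule det_mixture_coordinate[OF p])
    fix i assume "i \<in> I"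
    then obtain w where w: "w \<in> W" "U *v axis i 1 = P *v w" using U(3) by auto
    have "R *v (P *v w) = w" using R(2) by (simp add: matrix_vector_mul_assoc)
    then have "?Q *v axis i 1 = transpose U *v (Q *v w)"
      by (simp only: matrix_vector_mul_assoc[symmetric] w(2))
    also have "\<dots> = transpose U *v (U *v axis i 1)" by (simp add: agree w)
    also have "\<dots> = axis i 1"
      using U(1) by (simp add: matrix_vector_mul_assoc orthogonal_matrix del: matrix_vector_mult_basis)
    finally show "?Q *v axis i 1 = axis i 1" .
  next
    fix v
    have "P *v (R *v (U *v v)) = U *v v" using R(1) by (simp add: matrix_mul_assoc matrix_vector_mul_assoc)
    then show "(norm (?H *v v))\<^sup>2 = (1 - p) * (norm v)\<^sup>2 + p * (norm (?Q *v v))\<^sup>2"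
      using H[of "R *v (U *v v)"] by (simp only: matrix_vector_mul_assoc[symmetric] normU normU')
  qed
  moreover have "\<bar>det ?H\<bar> * \<bar>det P\<bar> = \<bar>det H\<bar>"
  proof -
    have "det R * det P = 1" by (metis R(2) det_I det_mul)
    moreover have "\<bar>det U\<bar> = 1" using det_orthogonal_matrix[OF U(1)] by auto
    ultimately show ?thesis by (simp add: det_mul abs_mult) (metis abs_mult abs_one mult.assoc mult.right_neutral)
  qed
  ultimately show ?thesis
    using mult_right_mono[of _ _ "\<bar>det P\<bar>"] cI by fastforce
qed simp

text \<open>
  A sum of squared norms of linear maps is again the squared norm of a single square matrix: the map
  \<open>v \<mapsto> (sqrt a P v, sqrt b Q v)\<close> has a range of dimension at most \<open>N\<close>, which embeds isometrically into
  the \<open>N\<close>-dimensional space. This plays the role of a Cholesky factorization.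
\<close>

lemma gram_of_sum:
  fixes P Q :: "real^'n^'n"
  assumes "0 \<le> a" "0 \<le> b"
  obtains H :: "real^'n^'n" where
    "\<And>v. (norm (H *v v))\<^sup>2 = a * (norm (P *v v))\<^sup>2 + b * (norm (Q *v v))\<^sup>2"
proof -
  define L where "L v = (sqrt a *\<^sub>R (P *v v), sqrt b *\<^sub>R (Q *v v))" for v
  have L: "linear L"
    unfolding L_def by (intro linearI) (auto simp: matrix_vector_right_distrib scaleR_right_distrib matrix_vector_mult_scaleR)
  have "dim (range L) \<le> dim (UNIV :: (real^'n) set)"
    using dim_image_le[OF L, of UNIV] by simp
  then obtain g :: "_ \<Rightarrow> real^'n" where g: "linear g" "\<And>x. x \<in> range L \<Longrightarrow> norm (g x) = norm x"
    using isometry_subset_subspace[OF linear_subspace_image[OF L subspace_UNIV] subspace_UNIV] by metis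
  have lin: "linear (g \<circ> L)" using L g(1) by (rule linear_compose)
  show ?thesis
  proof (rule that)
    fix v
    have "(norm (matrix (g \<circ> L) *v v))\<^sup>2 = (norm (L v))\<^sup>2"
      using g(2) lin by (simp add: matrix_works)
    then show "(norm (matrix (g \<circ> L) *v v))\<^sup>2 = a * (norm (P *v v))\<^sup>2 + b * (norm (Q *v v))\<^sup>2"
      using assms by (simp add: L_def norm_Pair power_mult_distrib)
  qed
qed

text \<open>
  On the segment from the identity to \<open>A\<close> the form is positive definite, hence invertible, up to the
  endpoint \<open>A\<close>, so the determinant cannot have changed sign.
\<close>

lemma det_psd_nonneg:
  fixes A :: "real^'n^'n"
  assumes psd: "\<And>v. 0 \<le> v \<bullet> (A *v v)"
  shows "0 \<le> det A"
proof (rule ccontr)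
  assume neg: "\<not> 0 \<le> det A"
  define g where "g s = det (s *\<^sub>R A + (1 - s) *\<^sub>R mat 1)" for s :: real
  have nz: "g s \<noteq> 0" if "0 \<le> s" "s < 1" for s
  proof
    assume "g s = 0"
    then have "\<not> invertible (s *\<^sub>R A + (1 - s) *\<^sub>R mat 1)"
      by (simp add: g_def invertible_det_nz)
    then obtain v where "v \<noteq> 0" and v: "(s *\<^sub>R A + (1 - s) *\<^sub>R mat 1) *v v = 0"
      by (auto simp: invertible_left_inverse matrix_left_invertible_ker)
    have "0 = v \<bullet> ((s *\<^sub>R A + (1 - s) *\<^sub>R mat 1) *v v)" by (simp add: v)
    also have "\<dots> = s * (v \<bullet> (A *v v)) + (1 - s) * (v \<bullet> v)"
      by (simp add: matrix_vector_mult_add_rdistrib inner_add_right scaleR_matrix_vector_assoc[symmetric])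
    also have "\<dots> > 0"
      using that psd[of v] \<open>v \<noteq> 0\<close> by (intro add_nonneg_pos) auto
    finally show False by simp
  qed
  have cont: "continuous_on {0..1} g"
    unfolding g_def det_def by (intro continuous_intros)
  have "\<exists>s\<ge>0. s \<le> 1 \<and> g s = 0"
    by (rule IVT2'[of g 1 0 0]) (use neg cont in \<open>auto simp: g_def\<close>)
  then obtain s where "0 \<le> s" "s \<le> 1" "g s = 0" by auto
  moreover have "g 1 \<noteq> 0" using neg by (simp add: g_def)
  ultimately show False using nz[of s] by (cases "s = 1") auto
qed

section \<open>The expected squared error\<close>

text \<open>
  The expected squared error after \<open>t\<close> steps as an explicit function of the current plant state \<open>x\<close> and
  observer state \<open>z\<close>, obtained by conditioning on whether the first measurement is erased.
\<close>

primrec mean_sq_error ::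
  "(real^'n \<Rightarrow> real^'n) \<Rightarrow> (real^'n \<Rightarrow> real^'m) \<Rightarrow> (real^'m \<Rightarrow> real^'n) \<Rightarrow> real \<Rightarrow> nat \<Rightarrow>
   real^'n \<Rightarrow> real^'n \<Rightarrow> real" where
  "mean_sq_error f h K p 0 x z = (norm (x - z))\<^sup>2"
| "mean_sq_error f h K p (Suc t) x z =
     (1 - p) * mean_sq_error f h K p t (f x) (f z) +
     p * mean_sq_error f h K p t (f x) (f z + K (h x) - K (h z))"

lemma bernoulli_prefix:
  assumes iid: "iid_bernoulli P \<xi> p" and p: "0 \<le> p" "p \<le> 1"
  shows "{\<omega>\<in>space P. \<forall>i<k. \<xi> i \<omega> = s i} \<in> sets P"
    and "measure P {\<omega>\<in>space P. \<forall>i<k. \<xi> i \<omega> = s i} = (\<Prod>i<k. if s i then p else 1 - p)"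
proof -
  interpret prob_space P using iid by (simp add: iid_bernoulli_def)
  have indep: "indep_vars (\<lambda>_. count_space UNIV) \<xi> UNIV"
    and distr: "\<And>t. distr P (count_space UNIV) (\<xi> t) = measure_pmf (bernoulli_pmf p)"
    using iid by (auto simp: iid_bernoulli_def)
  have rv: "random_variable (count_space UNIV) (\<xi> i)" for i
    using indep by (auto simp: indep_vars_def)
  have eq: "{\<omega>\<in>space P. \<forall>i<k. \<xi> i \<omega> = s i} = (\<Inter>i\<in>{..<k}. \<xi> i -` {s i} \<inter> space P) \<inter> space P"
    by auto
  have single: "\<xi> i -` {b} \<inter> space P \<in> sets P" for i b
    using measurable_sets[OF rv] by simp
  have single_prob: "prob (\<xi> i -` {b} \<inter> space P) = (if b then p else 1 - p)" for i b
  proof -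
    have "prob (\<xi> i -` {b} \<inter> space P) = measure (distr P (count_space UNIV) (\<xi> i)) {b}"
      by (simp add: measure_distr[OF rv])
    also have "\<dots> = pmf (bernoulli_pmf p) b"
      by (simp add: distr measure_pmf_single)
    finally show ?thesis using p by (cases b) simp_all
  qed
  show "{\<omega>\<in>space P. \<forall>i<k. \<xi> i \<omega> = s i} \<in> sets P"
    proof (cases "k = 0")
    case False
    then show ?thesis
      unfolding eq using single by (intro sets.Int[OF sets.finite_INT sets.top]) auto
  qed auto
  show "prob {\<omega>\<in>space P. \<forall>i<k. \<xi> i \<omega> = s i} = (\<Prod>i<k. if s i then p else 1 - p)"
  proof (cases "k = 0")
    case True
    then show ?thesis by (simp add: prob_space)
  next
    case False
    then have ne: "{..<k} \<noteq> {}" by auto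
    have "prob (\<Inter>i\<in>{..<k}. \<xi> i -` {s i} \<inter> space P) = (\<Prod>i<k. prob (\<xi> i -` {s i} \<inter> space P))"
      by (rule indep_varsD[OF indep ne]) auto
    moreover have "{\<omega>\<in>space P. \<forall>i<k. \<xi> i \<omega> = s i} = (\<Inter>i\<in>{..<k}. \<xi> i -` {s i} \<inter> space P)"
      using ne by auto
    ultimately show ?thesis by (simp add: single_prob)
  qed
qed

lemma observer_cong:
  "(\<And>i. i < t \<Longrightarrow> s i = s' i) \<Longrightarrow> observer f h K s x z t = observer f h K s' x z t"
  by (induction t) auto

text \<open>
  The induction runs over the number \<open>t\<close> of erasures that are still random, with the first \<open>k\<close> of them
  prescribed by \<open>s\<close>: splitting on \<open>\<xi> k\<close> replaces the prefix \<open>s\<close> by its two prolongations. In this form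
  independence enters only through the probability of a prefix, and the horizon \<open>n\<close> stays fixed.
\<close>

lemma expectation_given_prefix:
  assumes iid: "iid_bernoulli P \<xi> p" and p: "0 \<le> p" "p \<le> 1" and "k + t = n"
  shows "has_bochner_integral P
     (\<lambda>\<omega>. indicator {\<omega>\<in>space P. \<forall>i<k. \<xi> i \<omega> = s i} \<omega> *
           (norm ((f ^^ n) x - observer f h K (\<lambda>i. \<xi> i \<omega>) x z n))\<^sup>2)
     ((\<Prod>i<k. if s i then p else 1 - p) *
       mean_sq_error f h K p t ((f ^^ k) x) (observer f h K s x z k))"
  using \<open>k + t = n\<close>
proof (induction t arbitrary: k s)
  case 0
  then have [simp]: "n = k" by simp
  let ?A = "{\<omega>\<in>space P. \<forall>i<k. \<xi> i \<omega> = s i}"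
  let ?c = "(norm ((f ^^ k) x - observer f h K s x z k))\<^sup>2"
  interpret prob_space P using iid by (simp add: iid_bernoulli_def)
  have "has_bochner_integral P (indicator ?A) (measure P ?A)"
    by (rule has_bochner_integral_real_indicator[OF bernoulli_prefix(1)[OF iid p]])
      (simp add: emeasure_eq_measure)
  then have "has_bochner_integral P (\<lambda>\<omega>. indicator ?A \<omega> * ?c) (measure P ?A * ?c)"
    by (rule has_bochner_integral_mult_left)
  moreover have "indicator ?A \<omega> * ?c = indicator ?A \<omega> *
      (norm ((f ^^ k) x - observer f h K (\<lambda>i. \<xi> i \<omega>) x z k))\<^sup>2" for \<omega>
  proof (cases "\<omega> \<in> ?A")
    case True
    then have "observer f h K (\<lambda>i. \<xi> i \<omega>) x z k = observer f h K s x z k"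
      by (intro observer_cong) auto
    then show ?thesis by simp
  qed simp
  ultimately show ?case
    unfolding bernoulli_prefix(2)[OF iid p] by simp
next
  case (Suc t)
  define g where "g \<omega> = (norm ((f ^^ n) x - observer f h K (\<lambda>i. \<xi> i \<omega>) x z n))\<^sup>2" for \<omega>
  define A where "A k s = {\<omega>\<in>space P. \<forall>i<k. \<xi> i \<omega> = s i}" for k s
  define w where "w k s = (\<Prod>i<k. if s i then p else 1 - p)" for k :: nat and s
  let ?x = "(f ^^ k) x" and ?z = "observer f h K s x z k"
  let ?s = "\<lambda>b. s(k := b)"
  let ?V = "\<lambda>b. mean_sq_error f h K p t (f ?x) (observer f h K (?s b) x z (Suc k))"
  have IH: "has_bochner_integral P (\<lambda>\<omega>. indicator (A (Suc k) (?s b)) \<omega> * g \<omega>) (w (Suc k) (?s b) * ?V b)" for b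
  proof -
    have "Suc k + t = n" using Suc.prems by simp
    from Suc.IH[OF this, of "?s b"] show ?thesis
      unfolding A_def w_def g_def by (simp only: funpow.simps(2) o_apply)
  qed
  have w: "w (Suc k) (?s b) = w k s * (if b then p else 1 - p)" for b
    by (simp add: w_def)
  have obs: "observer f h K (?s b) x z k = ?z" for b
    by (rule observer_cong) simp
  have "indicator (A (Suc k) (?s False)) \<omega> * g \<omega> + indicator (A (Suc k) (?s True)) \<omega> * g \<omega>
      = indicator (A k s) \<omega> * g \<omega>" for \<omega>
    unfolding A_def by (cases "\<xi> k \<omega>") (auto simp: indicator_def less_Suc_eq)
  moreover have "w (Suc k) (?s False) * ?V False + w (Suc k) (?s True) * ?V True
      = w k s * mean_sq_error f h K p (Suc t) ?x ?z"
    unfolding w by (simp add: obs distrib_left mult.assoc)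
  ultimately show ?case
    using has_bochner_integral_add[OF IH[of False] IH[of True]]
    unfolding A_def w_def g_def by (simp only:)
qed

lemma expected_sq_error:
  assumes iid: "iid_bernoulli P \<xi> p" and p: "0 \<le> p" "p \<le> 1"
  shows "(\<integral>\<omega>. (norm (obs_error f h K (\<lambda>k. \<xi> k \<omega>) x e t))\<^sup>2 \<partial>P) = mean_sq_error f h K p t x (x - e)"
proof -
  have "has_bochner_integral P (\<lambda>\<omega>. indicator (space P) \<omega> * (norm (obs_error f h K (\<lambda>k. \<xi> k \<omega>) x e t))\<^sup>2)
      (mean_sq_error f h K p t x (x - e))"
    using expectation_given_prefix[OF assms, of 0 t t undefined f x h K "x - e"]
    by (simp add: obs_error_def)
  from has_bochner_integral_integral_eq[OF this] show ?thesis
    by (metis (no_types, lifting) Bochner_Integration.integral_cong indicator_simps(1) mult_1)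
qed

section \<open>Linearization of the expected error\<close>

text \<open>
  Approach to \<open>x\<close> along curved sequences is needed, because a map does not send points on a ray
  to points on a ray. The directional limit is preserved by differentiable maps, so it can be
  iterated.
\<close>

lemma tendsto_derivative_along:
  fixes f :: "'a::real_normed_vector \<Rightarrow> 'b::real_normed_vector"
  assumes der: "(f has_derivative f') (at x)"
    and z: "z \<longlonglongrightarrow> x" and e: "\<And>k. 0 < \<epsilon> k"
    and w: "(\<lambda>k. (z k - x) /\<^sub>R \<epsilon> k) \<longlonglongrightarrow> w"
  shows "(\<lambda>k. (f (z k) - f x) /\<^sub>R \<epsilon> k) \<longlonglongrightarrow> f' w"
proof -
  \<comment> \<open>The relative remainder of the first order expansion, continuous at \<open>x\<close> with value \<open>0\<close> there.\<close>
  define R where "R y = (if y = x then 0 else (1 / norm (y - x)) *\<^sub>R (f y - (f x + f' (y - x))))" for y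
  have bl: "bounded_linear f'" using der by (rule has_derivative_bounded_linear)
  have "((\<lambda>y. (1 / norm (y - x)) *\<^sub>R (f y - (f x + f' (y - x)))) \<longlongrightarrow> 0) (at x)"
    using der unfolding has_derivative_at2 by blast
  then have "(R \<longlongrightarrow> 0) (at x)"
    by (rule Lim_transform_eventually) (auto simp: R_def eventually_at_filter)
  then have "isCont R x" by (simp add: isCont_def R_def)
  then have R0: "(\<lambda>k. R (z k)) \<longlonglongrightarrow> 0"
    using isCont_tendsto_compose[OF _ z, of R] by (simp add: R_def)
  have "(f y - f x) = f' (y - x) + norm (y - x) *\<^sub>R R y" for y
    using linear_0[OF bounded_linear.linear[OF bl]] by (cases "y = x") (auto simp: R_def)
  then have eq: "(f (z k) - f x) /\<^sub>R \<epsilon> k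
      = f' ((z k - x) /\<^sub>R \<epsilon> k) + norm ((z k - x) /\<^sub>R \<epsilon> k) *\<^sub>R R (z k)" for k
    using less_imp_le[OF e[of k]]
    by (simp only: scaleR_right_distrib linear_cmul[OF bounded_linear.linear[OF bl]] norm_scaleR
      abs_of_nonneg scaleR_scaleR inverse_nonnegative_iff_nonnegative)
  have "(\<lambda>k. norm ((z k - x) /\<^sub>R \<epsilon> k) *\<^sub>R R (z k)) \<longlonglongrightarrow> norm w *\<^sub>R 0"
    by (intro tendsto_intros w R0)
  moreover have "(\<lambda>k. f' ((z k - x) /\<^sub>R \<epsilon> k)) \<longlonglongrightarrow> f' w"
    using bl w by (rule bounded_linear.tendsto)
  ultimately show ?thesis
    unfolding eq using tendsto_add by fastforce
qed

text \<open>
  The second moment of the linearized error started at \<open>v\<close>. Along an orbit with \<open>z = x\<close> the observer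
  reproduces the plant state for every erasure sequence, so the linearization is the random product
  with factors \<open>A\<close> (measurement lost) and \<open>A - B\<close> (measurement received), where \<open>A\<close> is the Jacobian of
  \<open>f\<close> and \<open>B\<close> that of \<open>K \<circ> h\<close>.
\<close>

primrec second_moment ::
  "(real^'n \<Rightarrow> real^'n) \<Rightarrow> (real^'n \<Rightarrow> real^'m) \<Rightarrow> (real^'m \<Rightarrow> real^'n) \<Rightarrow> real \<Rightarrow> nat \<Rightarrow>
   real^'n \<Rightarrow> real^'n \<Rightarrow> real" where
  "second_moment f h K p 0 x v = (norm v)\<^sup>2"
| "second_moment f h K p (Suc t) x v =
     (1 - p) * second_moment f h K p t (f x) (jacobian f (at x) *v v) +
     p * second_moment f h K p t (f x)
       ((jacobian f (at x) - jacobian K (at (h x)) ** jacobian h (at x)) *v v)"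

text \<open>
  Both branches of the recursion send the asymptotic direction \<open>w\<close> at \<open>x\<close> to an asymptotic direction at
  \<open>f x\<close>, with the same scale \<open>\<epsilon>\<close>, so the limit is carried along by induction.
\<close>

lemma mean_sq_error_linearization:
  assumes fX: "\<And>x. x \<in> X \<Longrightarrow> f x \<in> X"
    and f: "\<And>x. x \<in> X \<Longrightarrow> f differentiable (at x)"
    and h: "\<And>x. x \<in> X \<Longrightarrow> h differentiable (at x)"
    and K: "\<And>x. x \<in> X \<Longrightarrow> K differentiable (at (h x))"
    and e: "\<And>k. 0 < \<epsilon> k"
    and x: "x \<in> X" and z: "z \<longlonglongrightarrow> x"
    and w: "(\<lambda>k. (z k - x) /\<^sub>R \<epsilon> k) \<longlonglongrightarrow> w"
  shows "(\<lambda>k. mean_sq_error f h K p t x (z k) / (\<epsilon> k)\<^sup>2) \<longlonglongrightarrow> second_moment f h K p t x w"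
  using x z w
proof (induction t arbitrary: x z w)
  case 0
  have "(\<lambda>k. (norm ((z k - x) /\<^sub>R \<epsilon> k))\<^sup>2) \<longlonglongrightarrow> (norm w)\<^sup>2"
    by (intro tendsto_intros 0)
  moreover have "(norm ((z k - x) /\<^sub>R \<epsilon> k))\<^sup>2 = mean_sq_error f h K p 0 x (z k) / (\<epsilon> k)\<^sup>2" for k
  proof -
    have "norm ((z k - x) /\<^sub>R \<epsilon> k) = norm (x - z k) / \<epsilon> k"
      using less_imp_le[OF e[of k]]
      by (simp only: norm_scaleR norm_minus_commute[of "z k"] abs_of_nonneg
        inverse_nonnegative_iff_nonnegative divide_inverse mult.commute)
    then show ?thesis by (simp only: mean_sq_error.simps power_divide)
  qed
  ultimately show ?case by simp
next
  case (Suc t)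
  let ?A = "jacobian f (at x)"
  let ?B = "jacobian K (at (h x)) ** jacobian h (at x)"
  have df: "(f has_derivative (\<lambda>v. ?A *v v)) (at x)"
    using f[OF Suc.prems(1)] by (simp only: jacobian_works)
  have dh: "(h has_derivative (\<lambda>v. jacobian h (at x) *v v)) (at x)"
    using h[OF Suc.prems(1)] by (simp only: jacobian_works)
  have dK: "(K has_derivative (\<lambda>v. jacobian K (at (h x)) *v v)) (at (h x))"
    using K[OF Suc.prems(1)] by (simp only: jacobian_works)
  have "(K \<circ> h has_derivative (\<lambda>v. jacobian K (at (h x)) *v v) \<circ> (\<lambda>v. jacobian h (at x) *v v)) (at x)"
    using dh dK by (rule diff_chain_at)
  then have dKh: "((\<lambda>x. K (h x)) has_derivative (\<lambda>v. ?B *v v)) (at x)"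
    by (simp add: o_def matrix_vector_mul_assoc)
  define z' where "z' k = f (z k) + K (h x) - K (h (z k))" for k
  have fz: "(\<lambda>k. f (z k)) \<longlonglongrightarrow> f x"
    by (rule isCont_tendsto_compose[OF has_derivative_continuous[OF df] Suc.prems(2)])
  have Khz: "(\<lambda>k. K (h (z k))) \<longlonglongrightarrow> K (h x)"
    by (rule isCont_tendsto_compose[OF has_derivative_continuous[OF dKh] Suc.prems(2)])
  have z': "z' \<longlonglongrightarrow> f x"
    unfolding z'_def using tendsto_diff[OF tendsto_add[OF fz tendsto_const[of "K (h x)"]] Khz] by simp
  have wA: "(\<lambda>k. (f (z k) - f x) /\<^sub>R \<epsilon> k) \<longlonglongrightarrow> ?A *v w"
    by (rule tendsto_derivative_along[OF df Suc.prems(2) e Suc.prems(3)])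
  have wB: "(\<lambda>k. (K (h (z k)) - K (h x)) /\<^sub>R \<epsilon> k) \<longlonglongrightarrow> ?B *v w"
    by (rule tendsto_derivative_along[OF dKh Suc.prems(2) e Suc.prems(3)])
  have "(\<lambda>k. (z' k - f x) /\<^sub>R \<epsilon> k) \<longlonglongrightarrow> (?A - ?B) *v w"
  proof -
    have "z' k - f x = (f (z k) - f x) - (K (h (z k)) - K (h x))" for k
      by (simp add: z'_def)
    then show ?thesis
      using tendsto_diff[OF wA wB] by (simp only: scaleR_diff_right matrix_vector_mult_diff_rdistrib)
  qed
  then have limB: "(\<lambda>k. mean_sq_error f h K p t (f x) (z' k) / (\<epsilon> k)\<^sup>2)
      \<longlonglongrightarrow> second_moment f h K p t (f x) ((?A - ?B) *v w)"
    by (rule Suc.IH[OF fX[OF Suc.prems(1)] z'])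
  have limA: "(\<lambda>k. mean_sq_error f h K p t (f x) (f (z k)) / (\<epsilon> k)\<^sup>2)
      \<longlonglongrightarrow> second_moment f h K p t (f x) (?A *v w)"
    by (rule Suc.IH[OF fX[OF Suc.prems(1)] fz wA])
  have "mean_sq_error f h K p (Suc t) x (z k) / (\<epsilon> k)\<^sup>2
      = (1 - p) * (mean_sq_error f h K p t (f x) (f (z k)) / (\<epsilon> k)\<^sup>2) +
        p * (mean_sq_error f h K p t (f x) (z' k) / (\<epsilon> k)\<^sup>2)" for k
    by (simp only: mean_sq_error.simps z'_def add_divide_distrib times_divide_eq_right)
  then show ?case
    using tendsto_add[OF tendsto_mult_left[OF limA, of "1 - p"] tendsto_mult_left[OF limB, of p]]
    by (simp only: second_moment.simps)
qed

lemma continuous_mean_sq_error: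
  assumes fX: "\<And>x. x \<in> X \<Longrightarrow> f x \<in> X"
    and oX: "\<And>x z. x \<in> X \<Longrightarrow> z \<in> X \<Longrightarrow> f z + K (h x) - K (h z) \<in> X"
    and f: "continuous_on X f" and Kh: "continuous_on X (\<lambda>x. K (h x))"
    and x: "x \<in> X"
  shows "continuous_on X (mean_sq_error f h K p t x)"
  using x
proof (induction t arbitrary: x)
  case 0
  then show ?case by (auto intro!: continuous_intros)
next
  case (Suc t)
  have IH: "continuous_on X (mean_sq_error f h K p t (f x))"
    by (rule Suc.IH[OF fX[OF Suc.prems]])
  have "continuous_on X (\<lambda>z. mean_sq_error f h K p t (f x) (f z))"
    by (rule continuous_on_compose2[OF IH f]) (use fX in auto)
  moreover have "continuous_on X (\<lambda>z. mean_sq_error f h K p t (f x) (f z + K (h x) - K (h z)))"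
    by (rule continuous_on_compose2[OF IH]) (use oX Suc.prems f Kh in \<open>auto intro!: continuous_intros\<close>)
  ultimately show ?case
    unfolding mean_sq_error.simps by (intro continuous_intros)
qed

section \<open>A lower bound for the determinant of the second moment\<close>

lemma codim_kernel_le:
  fixes C :: "real^'n^'m"
  shows "CARD('n) - dim {v. C *v v = 0} \<le> CARD('m)"
proof -
  \<comment> \<open>The kernel is the orthogonal complement of the span of the at most \<open>M\<close> distinct rows.\<close>
  let ?V = "{v. \<forall>x\<in>span (rows C). orthogonal x v}"
  have "dim ?V + dim (span (rows C)) = CARD('n)"
    using dim_subspace_orthogonal_to_vectors[OF subspace_span subspace_UNIV, of "rows C"] by simp
  moreover have "dim (span (rows C)) \<le> CARD('m)"
  proof -
    have "rows C = (\<lambda>i. row i C) ` UNIV" by (auto simp: rows_def)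
    then have "dim (rows C) \<le> card ((\<lambda>i. row i C) ` UNIV)"
      using dim_le_card'[of "rows C"] by simp
    also have "\<dots> \<le> CARD('m)" by (rule card_image_le) simp
    finally show ?thesis by (simp add: dim_span)
  qed
  moreover have "?V \<subseteq> {v. C *v v = 0}"
  proof
    fix v assume "v \<in> ?V"
    then have "row i C \<bullet> v = 0" for i
      using span_base[of "row i C" "rows C"] by (auto simp: rows_def orthogonal_def)
    then show "v \<in> {v. C *v v = 0}"
      by (simp add: vec_eq_iff matrix_vector_mul_component row_def vec_lambda_eta)
  qed
  ultimately show ?thesis
    using dim_subset[of ?V "{v. C *v v = 0}"] by linarith
qed

text \<open>
  The key estimate. The matrix of the second moment is \<open>G' G\<close>, and each step contributes to \<open>\<bar>det G\<bar>\<close> the factor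
  \<open>\<bar>det A\<bar>\<close> times at worst \<open>sqrt (1 - p)\<close> to the power \<open>M\<close>: on the kernel of the Jacobian of \<open>h\<close>, which
  has codimension at most \<open>M\<close>, the received measurement changes nothing, as \<open>A - B\<close> agrees with \<open>A\<close>
  there.
\<close>

lemma second_moment_gram:
  fixes f :: "real^'n \<Rightarrow> real^'n" and h :: "real^'n \<Rightarrow> real^'m"
  assumes p: "0 \<le> p" "p \<le> 1"
  shows "\<exists>G::real^'n^'n. (\<forall>v. (norm (G *v v))\<^sup>2 = second_moment f h K p t x v) \<and>
    sqrt (1 - p) ^ (CARD('m) * t) * (\<Prod>k<t. \<bar>det (jacobian f (at ((f ^^ k) x)))\<bar>) \<le> \<bar>det G\<bar>"
proof (induction t arbitrary: x)
  case 0
  show ?case by (rule exI[of _ "mat 1"]) simp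
next
  case (Suc t)
  let ?c = "sqrt (1 - p)" and ?d = "\<lambda>x. \<bar>det (jacobian f (at x))\<bar>"
  let ?A = "jacobian f (at x)" and ?C = "jacobian h (at x)"
  let ?W = "{v. ?C *v v = 0}"
  obtain G :: "real^'n^'n" where G: "\<And>v. (norm (G *v v))\<^sup>2 = second_moment f h K p t (f x) v"
    and detG: "?c ^ (CARD('m) * t) * (\<Prod>k<t. ?d ((f ^^ k) (f x))) \<le> \<bar>det G\<bar>"
    using Suc.IH[of "f x"] by auto
  define P where "P = G ** ?A"
  define Q where "Q = G ** (?A - jacobian K (at (h x)) ** ?C)"
  obtain H :: "real^'n^'n" where H: "\<And>v. (norm (H *v v))\<^sup>2 = (1 - p) * (norm (P *v v))\<^sup>2 + p * (norm (Q *v v))\<^sup>2"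
    using gram_of_sum[of "1 - p" p P Q] p by auto
  have "?c ^ (CARD('n) - dim ?W) * \<bar>det P\<bar> \<le> \<bar>det H\<bar>"
  proof (rule det_mixture[OF p _ _ H])
    show "subspace ?W" by (auto simp: subspace_def matrix_vector_right_distrib matrix_vector_mult_scaleR)
    show "Q *v v = P *v v" if "v \<in> ?W" for v
      using that by (simp add: P_def Q_def matrix_vector_mul_assoc[symmetric] matrix_vector_mult_diff_rdistrib)
  qed
  moreover have "?c ^ CARD('m) \<le> ?c ^ (CARD('n) - dim ?W)"
    using p codim_kernel_le[of ?C] by (intro power_decreasing) auto
  ultimately have step: "?c ^ CARD('m) * \<bar>det P\<bar> \<le> \<bar>det H\<bar>"
    by (meson abs_ge_zero mult_right_mono order_trans)
  have "?c ^ (CARD('m) * Suc t) * (\<Prod>k<Suc t. ?d ((f ^^ k) x))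
      = ?c ^ CARD('m) * ((?c ^ (CARD('m) * t) * (\<Prod>k<t. ?d ((f ^^ k) (f x)))) * ?d x)"
    by (simp only: prod.lessThan_Suc_shift mult_Suc_right power_add funpow_Suc_right o_apply)
      (simp add: mult_ac)
  also have "\<dots> \<le> ?c ^ CARD('m) * (\<bar>det G\<bar> * ?d x)"
    using p by (intro mult_left_mono mult_right_mono detG) auto
  also have "\<dots> = ?c ^ CARD('m) * \<bar>det P\<bar>"
    by (simp add: P_def det_mul abs_mult)
  also have "\<dots> \<le> \<bar>det H\<bar>" by (rule step)
  finally show ?case
    using H G by (intro exI[of _ H]) (simp add: P_def Q_def matrix_vector_mul_assoc[symmetric])
qed

section \<open>Almost everywhere statements on compact sets\<close>

text \<open>
  The set of points of \<open>X\<close> at which \<open>X\<close> has positive measure locally is the support of Lebesgue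
  measure on \<open>X\<close>. It replaces the set of Lebesgue density points in the argument: it is closed, has full
  measure in \<open>X\<close>, and inequalities between continuous functions that hold almost everywhere on \<open>X\<close>
  hold at each of its points.
\<close>

lemma negligible_isolated_from_support:
  fixes X :: "'a::euclidean_space set"
  defines "X' \<equiv> {x \<in> X. \<forall>U. open U \<and> x \<in> U \<longrightarrow> \<not> negligible (X \<inter> U)}"
  shows "negligible (X - X')"
proof -
  let ?F = "{U. open U \<and> negligible (X \<inter> U)}"
  obtain F' where F': "F' \<subseteq> ?F" "countable F'" "\<Union>F' = \<Union>?F"
    using Lindelof[of ?F] by auto
  have "negligible (\<Union>U\<in>F'. X \<inter> U)"
    by (rule negligible_countable_Union) (use F' in auto)
  moreover have "X - X' \<subseteq> (\<Union>U\<in>F'. X \<inter> U)"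
    using F'(3) by (auto simp: X'_def)
  ultimately show ?thesis by (rule negligible_subset)
qed

lemma closed_support:
  fixes X :: "'a::euclidean_space set"
  assumes "closed X"
  shows "closed {x \<in> X. \<forall>U. open U \<and> x \<in> U \<longrightarrow> \<not> negligible (X \<inter> U)}"
proof -
  have eq: "{x \<in> X. \<forall>U. open U \<and> x \<in> U \<longrightarrow> \<not> negligible (X \<inter> U)}
      = X - \<Union>{U. open U \<and> negligible (X \<inter> U)}" by auto
  show ?thesis unfolding eq using assms by (intro closed_Diff open_Union) auto
qed

text \<open>
  Translation by a short vector \<open>\<epsilon> b\<close> moves \<open>C\<close> into a thin neighbourhood \<open>U\<close> of \<open>C\<close>, so the part of
  \<open>C\<close> that leaves \<open>C\<close> has measure at most that of \<open>U - C\<close>, which is as small as desired. This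
  directional statement does the work of the Lebesgue density theorem.
\<close>

lemma negligible_no_return_in_direction:
  fixes C :: "'a::euclidean_space set" and b :: 'a
  assumes C: "compact C" and d: "0 < d"
  shows "negligible {x \<in> C. \<forall>\<epsilon>. 0 < \<epsilon> \<and> \<epsilon> < d \<longrightarrow> x + \<epsilon> *\<^sub>R b \<notin> C}" (is "negligible ?N")
proof -
  have small: "\<exists>T\<in>lmeasurable. ?N \<subseteq> T \<and> measure lebesgue T \<le> e" if e: "0 < e" for e
  proof -
    have Cm: "C \<in> lmeasurable" using C by (rule lmeasurable_compact)
    obtain U where U: "open U" "C \<subseteq> U" "U - C \<in> lmeasurable" "emeasure lebesgue (U - C) < ennreal e"
      using sets_lebesgue_outer_open[OF fmeasurableD[OF Cm] e] by metis
    obtain \<delta> where \<delta>: "0 < \<delta>" "(\<Union>x\<in>C. ball x \<delta>) \<subseteq> U"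
      using compact_subset_open_imp_ball_epsilon_subset[OF C U(1,2)] by metis
    obtain \<epsilon> where \<epsilon>: "0 < \<epsilon>" "\<epsilon> < d" "\<epsilon> * norm b < \<delta>"
    proof
      \<comment> \<open>The summand \<open>1\<close> covers the case \<open>b = 0\<close>.\<close>
      let ?e = "min (d / 2) (\<delta> / (2 * (norm b + 1)))"
      show "0 < ?e" "?e < d" using d \<delta>(1) by (auto simp: add_nonneg_pos)
      have "?e * norm b \<le> (\<delta> / (2 * (norm b + 1))) * norm b"
        by (intro mult_right_mono) auto
      also have "\<dots> < \<delta>"
      proof -
        have "norm b / (2 * (norm b + 1)) < 1"
          using norm_ge_zero[of b] by (auto simp: divide_simps add_nonneg_pos)
        then have "\<delta> * (norm b / (2 * (norm b + 1))) < \<delta> * 1"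
          using \<delta>(1) by (rule mult_strict_left_mono)
        then show ?thesis by simp
      qed
      finally show "?e * norm b < \<delta>" .
    qed
    define C' where "C' = (+) (\<epsilon> *\<^sub>R b) ` C"
    have C'm: "C' \<in> lmeasurable" unfolding C'_def by (rule measurable_translation[OF Cm])
    have "C' - C \<subseteq> U - C"
    proof
      fix y assume y: "y \<in> C' - C"
      then obtain x where "x \<in> C" "y = \<epsilon> *\<^sub>R b + x" by (auto simp: C'_def)
      then have "y \<in> ball x \<delta>" using \<epsilon> by (simp add: dist_norm)
      with \<open>x \<in> C\<close> \<delta>(2) y show "y \<in> U - C" by blast
    qed
    then have "measure lebesgue (C' - C) \<le> measure lebesgue (U - C)"
      by (intro measure_mono_fmeasurable U(3)) (use C'm Cm in auto)
    also have "\<dots> \<le> e"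
      using U(3,4) e by (simp add: emeasure_eq_measure2 ennreal_less_iff less_imp_le)
    finally have le: "measure lebesgue (C' - C) \<le> e" .
    have T: "(+) (- (\<epsilon> *\<^sub>R b)) ` (C' - C) \<in> lmeasurable"
      using C'm Cm by (intro measurable_translation fmeasurable.Diff)
    moreover have "?N \<subseteq> (+) (- (\<epsilon> *\<^sub>R b)) ` (C' - C)"
    proof
      fix x assume x: "x \<in> ?N"
      then have "\<epsilon> *\<^sub>R b + x \<in> C' - C" using \<epsilon> by (auto simp: C'_def add.commute)
      then show "x \<in> (+) (- (\<epsilon> *\<^sub>R b)) ` (C' - C)"
        by (rule rev_image_eqI) simp
    qed
    ultimately show ?thesis
      using le by (intro bexI[OF _ T]) (simp add: measure_translation_subtract)
  qed
  then show ?thesis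
    unfolding negligible_outer_le by blast
qed

text \<open>
  By Fubini, for almost every \<open>x\<close> the relation \<open>R x z\<close> holds for almost all \<open>z\<close> in \<open>X\<close>; where it is
  closed in \<open>z\<close> it then extends to the whole support of Lebesgue measure on \<open>X\<close>.
\<close>

lemma AE_pair_good_support:
  fixes X :: "'a::euclidean_space set" and R :: "'a \<Rightarrow> 'a \<Rightarrow> bool"
  assumes ae: "AE (x, e) in (lborel :: ('a \<times> 'a) measure). x \<in> X \<and> x - e \<in> X \<longrightarrow> R x (x - e)"
    and closed: "\<And>x. x \<in> X \<Longrightarrow> closed {z \<in> X. R x z}"
  shows "AE x in lborel. x \<in> X \<longrightarrow>
    (\<forall>z\<in>X. (\<forall>U. open U \<and> z \<in> U \<longrightarrow> \<not> negligible (X \<inter> U)) \<longrightarrow> R x z)"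
proof -
  have "AE q in (lborel \<Otimes>\<^sub>M lborel :: ('a \<times> 'a) measure). fst q \<in> X \<and> fst q - snd q \<in> X \<longrightarrow> R (fst q) (fst q - snd q)"
    unfolding lborel_prod using ae by (simp only: case_prod_unfold)
  from lborel_pair.AE_pair[OF this]
  have ae2: "AE x in lborel. AE e in lborel. x \<in> X \<and> x - e \<in> X \<longrightarrow> R x (x - e)" by simp
  show ?thesis
  proof (rule AE_mp[OF ae2], rule AE_I2, safe)
    fix x z
    assume x: "x \<in> X" and z: "z \<in> X" and supp: "\<forall>U. open U \<and> z \<in> U \<longrightarrow> \<not> negligible (X \<inter> U)"
      and ae_e: "AE e in lborel. x \<in> X \<and> x - e \<in> X \<longrightarrow> R x (x - e)"
    have "AE y in (lborel :: 'a measure). y \<in> X \<longrightarrow> R x y"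
    proof -
      \<comment> \<open>The reflection \<open>e \<mapsto> x - e\<close> preserves Lebesgue measure and exchanges errors with observer
        states.\<close>
      have lb: "(lborel :: 'a measure) = distr lborel borel (\<lambda>e. x + (- 1) *\<^sub>R e)"
        using lborel_affine[of "- 1" x] by (simp add: density_1)
      have "AE e in distr lborel borel (\<lambda>e. x + (- 1) *\<^sub>R e). x - e \<in> X \<longrightarrow> R x (x - e)"
        using ae_e x unfolding lb[symmetric] by simp
      from AE_distrD[OF _ this] show ?thesis by simp
    qed
    then obtain N where N: "N \<in> null_sets lborel" "{y. \<not> (y \<in> X \<longrightarrow> R x y)} \<subseteq> N"
      by (auto simp: eventually_ae_filter)
    then have negN: "negligible {y \<in> X. \<not> R x y}"
      using negligible_subset[of N] by (auto simp: negligible_iff_null_sets intro: null_sets_completionI)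
    let ?V = "{y \<in> X. R x y}"
    show "R x z"
    proof (rule ccontr)
      assume "\<not> R x z"
      then have "\<not> negligible (X \<inter> - ?V)" using supp closed[OF x] by (auto simp: open_Compl)
      moreover have "X \<inter> - ?V = {y \<in> X. \<not> R x y}" by auto
      ultimately show False using negN by simp
    qed
  qed
qed

section \<open>Regularity of the Jacobian\<close>

lemma Cr_on_imp_continuous_on: "Cr_on r f U \<Longrightarrow> continuous_on U f"
  by (cases r) (auto intro!: continuous_at_imp_continuous_on differentiable_imp_continuous_within)

lemma Cr_near_1:
  assumes "Cr_near r f S" "1 \<le> r"
  shows Cr_near_differentiable: "x \<in> S \<Longrightarrow> f differentiable (at x)"
    and Cr_near_continuous_derivative:
      "b \<in> Basis \<Longrightarrow> continuous_on S (\<lambda>x. frechet_derivative f (at x) b)"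
proof -
  obtain U where U: "S \<subseteq> U" "Cr_on r f U"
    using assms(1) by (auto simp: Cr_near_def)
  obtain r' where r': "r = Suc r'" using assms(2) by (cases r) auto
  show "f differentiable (at x)" if "x \<in> S" using that U r' by auto
  show "continuous_on S (\<lambda>x. frechet_derivative f (at x) b)" if "b \<in> Basis"
    using that U r' by (auto intro: continuous_on_subset[OF Cr_on_imp_continuous_on])
qed

lemma continuous_on_det_jacobian:
  fixes f :: "real^'n \<Rightarrow> real^'n"
  assumes "Cr_near r f S" "1 \<le> r"
  shows "continuous_on S (\<lambda>x. det (jacobian f (at x)))"
proof -
  have "continuous_on S (\<lambda>x. jacobian f (at x) $ i $ j)" for i j
    unfolding jacobian_def matrix_def
    using Cr_near_continuous_derivative[OF assms, of "axis j 1"]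
    by (simp add: continuous_on_component axis_in_Basis_iff)
  then show ?thesis
    unfolding det_def by (intro continuous_on_sum continuous_on_mult continuous_on_const continuous_on_prod)
qed

lemma mat_vector_mult: "mat a *v v = a *\<^sub>R (v :: real^'n)"
  by (simp add: vec_eq_iff matrix_vector_mult_def mat_def if_distrib[of "\<lambda>x. x * _"] cong: if_cong)

lemma det_jacobian_nonzero:
  assumes "0 < a" "loewner_le (mat a) (transpose J ** J)"
  shows "det J \<noteq> 0"
proof
  assume "det J = 0"
  then have "\<not> invertible J" by (simp add: invertible_det_nz)
  then obtain v where v: "v \<noteq> 0" "J *v v = 0"
    by (auto simp: invertible_left_inverse matrix_left_invertible_ker)
  have "0 \<le> v \<bullet> ((transpose J ** J - mat a) *v v)"
    using assms(2) unfolding loewner_le_def psd_def by blast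
  also have "\<dots> = - a * (v \<bullet> v)"
    using v(2) by (simp add: matrix_vector_mult_diff_rdistrib matrix_vector_mul_assoc[symmetric]
        inner_diff_right mat_vector_mult)
  also have "\<dots> < 0" using v(1) assms(1) by simp
  finally show False by simp
qed

section \<open>Lyapunov exponents and invariant measures\<close>

lemma det_matpow: "det (matpow A k) = det A ^ k"
  by (induction k) (simp_all add: matpow_def det_mul)

lemma det_deriv_cocycle: "det (deriv_cocycle f x t) = (\<Prod>k\<le>t. det (jacobian f (at ((f ^^ k) x))))"
  by (induction t) (simp_all add: det_mul mult.commute)

lemma det_ordered_eigenvalues:
  assumes "ordered_eigenvalues (A :: real^'n^'n) lam"
  shows "det A = (\<Prod>k=1..CARD('n). lam k)"
proof -
  have "det (- A) = (\<Prod>k=1..CARD('n). - lam k)"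
    using assms unfolding ordered_eigenvalues_def by (elim conjE allE[of _ 0]) simp
  moreover have "det (- A) = (- 1) ^ CARD('n) * det A"
  proof -
    have "- A = mat (- 1) ** A"
      by (simp add: vec_eq_iff matrix_matrix_mult_def mat_def if_distrib[of "\<lambda>x. x * _"] cong: if_cong)
    then show ?thesis by (simp add: det_mul det_diagonal mat_def)
  qed
  moreover have "(\<Prod>k=1..CARD('n). - lam k) = (- 1) ^ CARD('n) * (\<Prod>k=1..CARD('n). lam k)"
    using prod.distrib[of "\<lambda>_. - 1" lam "{1..CARD('n)}"] by simp
  ultimately show ?thesis by simp
qed

text \<open>
  The determinant turns the limit defining the Lyapunov exponents into a Birkhoff average: the
  \<open>2t\<close>-th power of \<open>det (R t)\<close> is the squared determinant of a product of \<open>t + 1\<close> Jacobians.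
\<close>

lemma tendsto_ln_det_average:
  fixes f :: "real^'n \<Rightarrow> real^'n"
  assumes nz: "\<And>k. det (jacobian f (at ((f ^^ k) x))) \<noteq> 0"
    and lim: "lyapunov_limit f x Lam" and Lam: "det Lam \<noteq> 0"
  shows "(\<lambda>n. (1 / real n) * (\<Sum>k=0..n. ln \<bar>det (jacobian f (at ((f ^^ k) x)))\<bar>)) \<longlonglongrightarrow> ln (det Lam)"
    and "0 < det Lam"
proof -
  let ?J = "\<lambda>k. det (jacobian f (at ((f ^^ k) x)))"
  obtain R where R: "\<And>t. 1 \<le> t \<Longrightarrow> psd (R t)"
      "\<And>t. 1 \<le> t \<Longrightarrow> matpow (R t) (2 * t) = transpose (deriv_cocycle f x t) ** deriv_cocycle f x t"
      "R \<longlonglongrightarrow> Lam"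
    using lim unfolding lyapunov_limit_def by blast
  have detR: "(\<lambda>t. det (R t)) \<longlonglongrightarrow> det Lam"
    unfolding det_def by (intro tendsto_intros tendsto_vec_nth R(3))
  have nonneg: "0 \<le> det (R t)" if "1 \<le> t" for t
    using R(1)[OF that] by (intro det_psd_nonneg) (simp add: psd_def)
  have "0 \<le> det Lam"
    by (rule tendsto_lowerbound[OF detR]) (use nonneg in \<open>auto simp: eventually_at_top_linorder\<close>)
  then show pos: "0 < det Lam" using Lam by simp
  have eq: "ln (det (R t)) = (1 / real t) * (\<Sum>k=0..t. ln \<bar>?J k\<bar>)" if t: "1 \<le> t" for t
  proof -
    let ?D = "\<Prod>k\<le>t. \<bar>?J k\<bar>"
    have "det (R t) ^ (2 * t) = (det (deriv_cocycle f x t))\<^sup>2"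
      using arg_cong[OF R(2)[OF t], of det] by (simp add: det_matpow det_mul power2_eq_square)
    also have "\<dots> = ?D\<^sup>2"
      unfolding det_deriv_cocycle by (simp only: abs_prod[symmetric] power2_abs)
    finally have pw: "det (R t) ^ (2 * t) = ?D\<^sup>2" .
    have "real (2 * t) * ln (det (R t)) = real 2 * ln ?D"
      by (metis ln_realpow pw)
    moreover have "ln ?D = (\<Sum>k\<le>t. ln \<bar>?J k\<bar>)"
      by (rule ln_prod) (use nz in simp_all)
    ultimately have "real t * ln (det (R t)) = (\<Sum>k\<le>t. ln \<bar>?J k\<bar>)" by simp
    then show ?thesis
      using t by (simp add: field_simps atMost_atLeast0)
  qed
  have "(\<lambda>t. ln (det (R t))) \<longlonglongrightarrow> ln (det Lam)"
    using detR pos by (intro tendsto_ln) auto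
  then show "(\<lambda>n. (1 / real n) * (\<Sum>k=0..n. ln \<bar>?J k\<bar>)) \<longlonglongrightarrow> ln (det Lam)"
    by (rule Lim_transform_eventually) (use eq in \<open>auto simp: eventually_at_top_linorder\<close>)
qed

lemma integral_invariant:
  fixes \<phi> :: "real^'n \<Rightarrow> real"
  assumes inv: "invariant_measure X f \<mu>" and fX: "f ` X \<subseteq> X" and f: "continuous_on X f"
    and \<phi>: "continuous_on X \<phi>"
  shows "(\<lambda>x. \<phi> ((f ^^ k) x)) \<in> borel_measurable \<mu>"
    and "(\<integral>x. \<phi> ((f ^^ k) x) \<partial>\<mu>) = (\<integral>x. \<phi> x \<partial>\<mu>)"
proof -
  interpret prob_space \<mu> using inv by (simp add: invariant_measure_def)
  have sets: "sets \<mu> = sets (restrict_space borel X)"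
    and meas: "\<And>B. B \<in> sets \<mu> \<Longrightarrow> measure \<mu> (f -` B \<inter> X) = measure \<mu> B"
    using inv by (auto simp: invariant_measure_def)
  have space: "space \<mu> = X"
    using sets_eq_imp_space_eq[OF sets] by (simp add: space_restrict_space)
  have meas_eq: "measurable \<mu> N = measurable (restrict_space borel X) N" for N :: "'b measure"
    by (rule measurable_cong_sets[OF sets refl])
  have "f \<in> measurable (restrict_space borel X) (restrict_space borel X)"
    using fX by (intro measurable_restrict_space2 borel_measurable_continuous_on_restrict f)
      (auto simp: space_restrict_space)
  then have fm: "f \<in> measurable \<mu> \<mu>"
    using measurable_cong_sets[OF sets sets] by blast
  have distr: "distr \<mu> \<mu> f = \<mu>"
  proof (rule measure_eqI)
    fix B assume "B \<in> sets (distr \<mu> \<mu> f)"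
    then have B: "B \<in> sets \<mu>" by simp
    show "emeasure (distr \<mu> \<mu> f) B = emeasure \<mu> B"
      using meas[OF B] by (simp add: emeasure_distr[OF fm B] emeasure_eq_measure space)
  qed simp
  have \<phi>m: "\<phi> \<in> borel_measurable \<mu>"
    unfolding meas_eq by (rule borel_measurable_continuous_on_restrict[OF \<phi>])
  have fk: "f ^^ k \<in> measurable \<mu> \<mu>" for k
    by (induction k) (auto intro: measurable_compose[OF _ fm] simp: o_def)
  show "(\<lambda>x. \<phi> ((f ^^ k) x)) \<in> borel_measurable \<mu>"
    by (rule measurable_compose[OF fk \<phi>m])
  show "(\<integral>x. \<phi> ((f ^^ k) x) \<partial>\<mu>) = (\<integral>x. \<phi> x \<partial>\<mu>)"
  proof (induction k)
    case (Suc k)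
    have "(\<integral>x. \<phi> ((f ^^ k) (f x)) \<partial>\<mu>) = (\<integral>x. \<phi> ((f ^^ k) x) \<partial>distr \<mu> \<mu> f)"
      by (rule integral_distr[symmetric, OF fm measurable_compose[OF fk \<phi>m]])
    then show ?case
      using Suc by (simp add: distr funpow_Suc_right del: funpow.simps)
  qed simp
qed

text \<open>
  By invariance all Birkhoff averages have the same integral, up to the factor \<open>(n + 1) / n\<close> from the
  \<open>n + 1\<close> summands, and they are uniformly bounded, so their almost sure limit \<open>c\<close> has that integral.
\<close>

lemma integral_eq_of_birkhoff_limit:
  fixes \<phi> :: "real^'n \<Rightarrow> real"
  assumes inv: "invariant_measure X f \<mu>" and fX: "f ` X \<subseteq> X" and f: "continuous_on X f"
    and \<phi>: "continuous_on X \<phi>" and X: "compact X"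
    and lim: "AE x in \<mu>. (\<lambda>n. (1 / real n) * (\<Sum>k=0..n. \<phi> ((f ^^ k) x))) \<longlonglongrightarrow> c"
  shows "(\<integral>x. \<phi> x \<partial>\<mu>) = c"
proof -
  interpret prob_space \<mu> using inv by (simp add: invariant_measure_def)
  have space: "space \<mu> = X"
    using inv sets_eq_imp_space_eq[of \<mu> "restrict_space borel X"]
    by (simp add: invariant_measure_def space_restrict_space)
  have "bounded (\<phi> ` X)" using compact_continuous_image[OF \<phi> X] by (rule compact_imp_bounded)
  then obtain C where C: "\<And>x. x \<in> X \<Longrightarrow> \<bar>\<phi> x\<bar> \<le> C" by (auto simp: bounded_iff)
  have orbit: "(f ^^ k) x \<in> X" if "x \<in> X" for k x
    using that fX by (induction k) auto
  note m = integral_invariant[OF inv fX f \<phi>]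
  have int: "integrable \<mu> (\<lambda>x. \<phi> ((f ^^ k) x))" for k
    by (rule integrable_const_bound[of _ C]) (use m(1) C orbit space in auto)
  let ?s = "\<lambda>n x. (1 / real n) * (\<Sum>k=0..n. \<phi> ((f ^^ k) x))"
  have lim_c: "(\<lambda>n. \<integral>x. ?s n x \<partial>\<mu>) \<longlonglongrightarrow> (\<integral>x. c \<partial>\<mu>)"
  proof (rule integral_dominated_convergence[where w = "\<lambda>_. 2 * C"])
    show "?s n \<in> borel_measurable \<mu>" for n
      using m(1) by (intro borel_measurable_times borel_measurable_sum) auto
    show "AE x in \<mu>. norm (?s n x) \<le> 2 * C" for n
    proof (rule AE_I2)
      fix x assume "x \<in> space \<mu>"
      then have x: "x \<in> X" by (simp add: space)
      have C0: "0 \<le> C" using C[OF x] by simp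
      have "\<bar>\<Sum>k=0..n. \<phi> ((f ^^ k) x)\<bar> \<le> (\<Sum>k=0..n. C)"
        by (rule order_trans[OF sum_abs sum_mono]) (use C orbit x in auto)
      then have "\<bar>?s n x\<bar> \<le> (1 / real n) * (real (Suc n) * C)"
        by (simp add: abs_mult divide_right_mono)
      also have "\<dots> \<le> 2 * C"
      proof (cases "n = 0")
        case False
        then have "real (Suc n) / real n \<le> 2" by (simp add: field_simps)
        from mult_right_mono[OF this C0] show ?thesis by simp
      qed (use C0 in simp)
      finally show "norm (?s n x) \<le> 2 * C" by simp
    qed
  qed (use lim in auto)
  have avg: "(\<integral>x. ?s n x \<partial>\<mu>) = (1 / real n * real (Suc n)) * (\<integral>x. \<phi> x \<partial>\<mu>)" for n
    using int m(2) by (simp add: Bochner_Integration.integral_sum)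
  have "(\<lambda>n. (1 / real n * real (Suc n)) * (\<integral>x. \<phi> x \<partial>\<mu>)) \<longlonglongrightarrow> 1 * (\<integral>x. \<phi> x \<partial>\<mu>)"
    by (intro tendsto_mult_right) (use LIMSEQ_Suc_n_over_n in \<open>simp add: field_simps\<close>)
  then have "(\<lambda>n. \<integral>x. ?s n x \<partial>\<mu>) \<longlonglongrightarrow> (\<integral>x. \<phi> x \<partial>\<mu>)"
    unfolding avg by simp
  then have "(\<integral>x. \<phi> x \<partial>\<mu>) = (\<integral>x. c \<partial>\<mu>)"
    using lim_c by (rule LIMSEQ_unique)
  then show ?thesis by (simp add: prob_space)
qed

section \<open>Stability and the growth of the linearized error\<close>

lemma AE_not_in_negligible: "negligible N \<Longrightarrow> AE x in lborel. x \<notin> N"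
  using AE_not_in[of N lebesgue] by (simp add: negligible_iff_null_sets AE_completion_iff)

text \<open>
  Mean square stability compares the error with its initial size at almost all pairs of initial
  states. At almost every \<open>x\<close> in \<open>X\<close> there are observer states \<open>x + \<epsilon> e\<^sub>j\<close> in the support of Lebesgue
  measure on \<open>X\<close> with arbitrarily small \<open>\<epsilon> > 0\<close>; dividing by \<open>\<epsilon>\<^sup>2\<close> and letting \<open>\<epsilon>\<close> tend to \<open>0\<close> turns
  stability into decay of the linearized second moment along each coordinate axis.
\<close>

lemma AE_second_moment_le:
  fixes f :: "real^'n \<Rightarrow> real^'n" and h :: "real^'n \<Rightarrow> real^'m"
  assumes X: "compact X" and fX: "f ` X \<subseteq> X"
    and oX: "\<And>x z. x \<in> X \<Longrightarrow> z \<in> X \<Longrightarrow> f z + K (h x) - K (h z) \<in> X"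
    and f: "\<And>x. x \<in> X \<Longrightarrow> f differentiable (at x)"
    and h: "\<And>x. x \<in> X \<Longrightarrow> h differentiable (at x)"
    and K: "\<And>x. x \<in> X \<Longrightarrow> K differentiable (at (h x))"
    and iid: "iid_bernoulli P \<xi> p" and p: "0 \<le> p" "p \<le> 1"
    and mse: "mse_stable X f h K P \<xi>"
  obtains L \<beta> where "0 < L" "0 < \<beta>" "\<beta> < 1"
    "AE x in lborel. x \<in> X \<longrightarrow> (\<forall>t j. second_moment f h K p (Suc t) x (axis j 1) \<le> L * \<beta> ^ t)"
proof -
  obtain L \<beta> where L: "0 < L" and \<beta>: "0 < \<beta>" "\<beta> < 1"
    and ae: "AE (x, e) in (lborel :: ((real^'n) \<times> (real^'n)) measure). x \<in> X \<and> x - e \<in> X \<longrightarrow>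
      (\<forall>t. (\<integral>\<omega>. (norm (obs_error f h K (\<lambda>k. \<xi> k \<omega>) x e (Suc t)))\<^sup>2 \<partial>P) \<le> L * \<beta> ^ t * (norm e)\<^sup>2)"
    using mse unfolding mse_stable_def by blast
  define V where "V t x z = mean_sq_error f h K p (Suc t) x z" for t x z
  define R where "R x z \<longleftrightarrow> (\<forall>t. V t x z \<le> L * \<beta> ^ t * (norm (x - z))\<^sup>2)" for x z
  define X' where "X' = {x \<in> X. \<forall>U. open U \<and> x \<in> U \<longrightarrow> \<not> negligible (X \<inter> U)}"
  have contf: "continuous_on X f"
    using f by (intro continuous_at_imp_continuous_on) (auto intro: differentiable_imp_continuous_within)
  have contKh: "continuous_on X (\<lambda>x. K (h x))"
    using h K by (intro continuous_at_imp_continuous_on ballI isCont_o2[of _ h K])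
      (auto intro: differentiable_imp_continuous_within)
  have fX': "\<And>x. x \<in> X \<Longrightarrow> f x \<in> X" using fX by auto
  have "compact X'"
    unfolding X'_def using compact_Int_closed[OF X closed_support[OF compact_imp_closed[OF X]]]
    by (simp add: Int_absorb1 subset_eq)
  have ae': "AE (x, e) in (lborel :: ((real^'n) \<times> (real^'n)) measure).
      x \<in> X \<and> x - e \<in> X \<longrightarrow> R x (x - e)"
    using ae by (simp add: expected_sq_error[OF iid p] R_def V_def del: mean_sq_error.simps)
  have close_all: "AE x in lborel. x \<in> X \<longrightarrow>
    (\<forall>z\<in>X. (\<forall>U. open U \<and> z \<in> U \<longrightarrow> \<not> negligible (X \<inter> U)) \<longrightarrow> R x z)"
  proof (rule AE_pair_good_support[OF ae'])
    fix x assume x: "x \<in> X"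
    have "{z \<in> X. R x z} = (\<Inter>t. {z \<in> X. V t x z \<le> L * \<beta> ^ t * (norm (x - z))\<^sup>2})"
      by (auto simp: R_def)
    moreover have "closed {z \<in> X. V t x z \<le> L * \<beta> ^ t * (norm (x - z))\<^sup>2}" for t
    proof (rule continuous_on_closed_Collect_le[OF _ _ compact_imp_closed[OF X]])
      show "continuous_on X (V t x)"
        unfolding V_def by (rule continuous_mean_sq_error[where X = X]) (use fX' oX contf contKh x in auto)
      show "continuous_on X (\<lambda>z. L * \<beta> ^ t * (norm (x - z))\<^sup>2)"
        by (intro continuous_intros)
    qed
    ultimately show "closed {z \<in> X. R x z}" by auto
  qed
  have "AE x in lborel. x \<in> X' \<longrightarrow>
      (\<forall>j n. \<exists>\<epsilon>. 0 < \<epsilon> \<and> \<epsilon> < inverse (real (Suc n)) \<and> x + \<epsilon> *\<^sub>R axis j 1 \<in> X')"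
  proof -
    have "AE x in lborel. \<forall>j. \<forall>n. x \<notin> {x \<in> X'. \<forall>\<epsilon>. 0 < \<epsilon> \<and> \<epsilon> < inverse (real (Suc n)) \<longrightarrow>
        x + \<epsilon> *\<^sub>R axis j (1::real) \<notin> X'}"
      unfolding AE_all_countable
      by (intro allI AE_not_in_negligible negligible_no_return_in_direction \<open>compact X'\<close>) auto
    then show ?thesis by (rule AE_mp) (auto intro!: AE_I2)
  qed
  moreover have "AE x in lborel. x \<notin> X - X'"
    using AE_not_in_negligible[OF negligible_isolated_from_support[of X]] by (simp add: X'_def)
  ultimately have "AE x in lborel. x \<in> X \<longrightarrow>
      (\<forall>t j. second_moment f h K p (Suc t) x (axis j 1) \<le> L * \<beta> ^ t)"
    using close_all
  proof eventually_elim
    case (elim x)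
    show ?case
    proof (intro impI allI)
      fix t and j :: 'n
      assume x: "x \<in> X"
      then have "x \<in> X'" using elim by auto
      then have "\<forall>n. \<exists>\<epsilon>. 0 < \<epsilon> \<and> \<epsilon> < inverse (real (Suc n)) \<and> x + \<epsilon> *\<^sub>R axis j 1 \<in> X'"
        using elim by blast
      then obtain \<epsilon> where \<epsilon>: "\<And>n. 0 < \<epsilon> n" "\<And>n. \<epsilon> n < inverse (real (Suc n))"
          "\<And>n. x + \<epsilon> n *\<^sub>R axis j 1 \<in> X'"
        by metis
      define z where "z n = x + \<epsilon> n *\<^sub>R axis j 1" for n
      have "\<epsilon> \<longlonglongrightarrow> 0"
        by (rule tendsto_sandwich[OF _ _ tendsto_const LIMSEQ_inverse_real_of_nat])
          (simp_all add: less_imp_le[OF \<epsilon>(1)] less_imp_le[OF \<epsilon>(2)] del: of_nat_Suc)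
      then have "z \<longlonglongrightarrow> x + 0 *\<^sub>R axis j 1"
        unfolding z_def by (intro tendsto_intros)
      then have z: "z \<longlonglongrightarrow> x" by simp
      have dir: "(z n - x) /\<^sub>R \<epsilon> n = axis j 1" for n
        using \<epsilon>(1)[of n] by (simp add: z_def)
      have lim: "(\<lambda>n. V t x (z n) / (\<epsilon> n)\<^sup>2) \<longlonglongrightarrow> second_moment f h K p (Suc t) x (axis j 1)"
        unfolding V_def
        by (rule mean_sq_error_linearization[OF fX' f h K \<epsilon>(1) x z]) (simp_all add: dir)
      have "V t x (z n) / (\<epsilon> n)\<^sup>2 \<le> L * \<beta> ^ t" for n
      proof -
        have "z n \<in> X'" using \<epsilon>(3) by (simp add: z_def)
        then have "R x (z n)" using elim x by (auto simp: X'_def)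
        then have "V t x (z n) \<le> L * \<beta> ^ t * (norm (x - z n))\<^sup>2" by (simp add: R_def)
        also have "norm (x - z n) = \<epsilon> n" using \<epsilon>(1)[of n] by (simp add: z_def)
        finally show ?thesis using \<epsilon>(1)[of n] by (simp add: divide_le_eq)
      qed
      then show "second_moment f h K p (Suc t) x (axis j 1) \<le> L * \<beta> ^ t"
        by (intro LIMSEQ_le_const2[OF lim]) auto
    qed
  qed
  with L \<beta> show ?thesis by (rule that)
qed

text \<open>
  Taking logarithms, dividing by \<open>t\<close> and letting \<open>t\<close> tend to infinity removes the constants \<open>C\<close> and \<open>L\<close>.
\<close>

lemma growth_rate_le:
  fixes d :: "nat \<Rightarrow> real"
  assumes c: "0 < c" and d: "\<And>k. d k \<noteq> 0" and C: "0 < C" and L: "0 < L" and \<beta>: "0 < \<beta>"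
    and le: "\<And>t. c ^ (m * Suc t) * (\<Prod>k<Suc t. \<bar>d k\<bar>) \<le> C * sqrt (L * \<beta> ^ t) ^ N"
    and lim: "(\<lambda>n. (1 / real n) * (\<Sum>k=0..n. ln \<bar>d k\<bar>)) \<longlonglongrightarrow> l"
  shows "real m * ln c + l \<le> real N * (ln \<beta> / 2)"
proof (rule LIMSEQ_le)
  let ?a = "\<lambda>n. (1 / real n) * (\<Sum>k=0..n. ln \<bar>d k\<bar>)"
  let ?u = "\<lambda>n. real m * ln c * (real (Suc n) / real n) + ?a n"
  let ?v = "\<lambda>n. (ln C + real N * (ln L / 2)) * (1 / real n) + real N * (ln \<beta> / 2)"
  have "?u \<longlonglongrightarrow> real m * ln c * 1 + l"
    by (intro tendsto_intros lim LIMSEQ_Suc_n_over_n)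
  then show "?u \<longlonglongrightarrow> real m * ln c + l" by simp
  have "?v \<longlonglongrightarrow> (ln C + real N * (ln L / 2)) * 0 + real N * (ln \<beta> / 2)"
    by (intro tendsto_intros lim_1_over_n)
  then show "?v \<longlonglongrightarrow> real N * (ln \<beta> / 2)" by simp
  have "?u t \<le> ?v t" if t: "1 \<le> t" for t
  proof -
    have "0 < (\<Prod>k<Suc t. \<bar>d k\<bar>)" using d by (intro prod_pos) simp
    then have "ln (c ^ (m * Suc t) * (\<Prod>k<Suc t. \<bar>d k\<bar>)) \<le> ln (C * sqrt (L * \<beta> ^ t) ^ N)"
      using c by (intro ln_mono le) auto
    also have "ln (c ^ (m * Suc t) * (\<Prod>k<Suc t. \<bar>d k\<bar>))
        = real (m * Suc t) * ln c + ln (\<Prod>k<Suc t. \<bar>d k\<bar>)"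
      using c d by (subst ln_mult) (auto simp: ln_realpow)
    also have "ln (\<Prod>k<Suc t. \<bar>d k\<bar>) = (\<Sum>k<Suc t. ln \<bar>d k\<bar>)"
      by (rule ln_prod) (use d in simp_all)
    also have "(\<Sum>k<Suc t. ln \<bar>d k\<bar>) = (\<Sum>k=0..t. ln \<bar>d k\<bar>)"
      by (simp only: lessThan_Suc_atMost atMost_atLeast0)
    also have "ln (C * sqrt (L * \<beta> ^ t) ^ N) = ln C + real N * ((ln L + real t * ln \<beta>) / 2)"
      using C L \<beta> by (simp add: ln_mult ln_realpow ln_sqrt)
    finally have "real m * real (Suc t) * ln c + (\<Sum>k=0..t. ln \<bar>d k\<bar>)
        \<le> ln C + real N * ((ln L + real t * ln \<beta>) / 2)" by (simp only: of_nat_mult)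
    then have "(real m * real (Suc t) * ln c + (\<Sum>k=0..t. ln \<bar>d k\<bar>)) / real t
        \<le> (ln C + real N * ((ln L + real t * ln \<beta>) / 2)) / real t"
      by (rule divide_right_mono) simp
    moreover have "(real m * real (Suc t) * ln c + (\<Sum>k=0..t. ln \<bar>d k\<bar>)) / real t = ?u t"
      by (simp add: add_divide_distrib mult_ac del: of_nat_Suc)
    moreover have "(ln C + real N * ((ln L + real t * ln \<beta>) / 2)) / real t = ?v t"
      using t by (simp add: field_simps)
    ultimately show ?thesis by simp
  qed
  then show "\<exists>N. \<forall>n\<ge>N. ?u n \<le> ?v n" by blast
qed

section \<open>The limitation theorem\<close>

theorem theorem20:
  fixes X :: "(real^'n) set" and Y :: "(real^'m) set"
    and f :: "real^'n \<Rightarrow> real^'n" and h :: "real^'n \<Rightarrow> real^'m" and K :: "real^'m \<Rightarrow> real^'n"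
    and r rK :: nat and p :: real
    and P :: "'w measure" and \<xi> :: "nat \<Rightarrow> 'w \<Rightarrow> bool"
    and \<mu> :: "(real^'n) measure" and lam :: "nat \<Rightarrow> real"
  assumes "CARD('m) < CARD('n)"
    and "compact X"
    and "1 \<le> r" and "system_assms r X Y f h"
    and "1 \<le> rK" and "observer_assms rK X Y f h K"
    and "0 < p" and "p < 1" and "iid_bernoulli P \<xi> p"
    and "physical_measure X f \<mu>" and "\<And>\<nu>. physical_measure X f \<nu> \<Longrightarrow> \<nu> = \<mu>"
    and "exp_lyapunov_exponents f \<mu> lam"
    and "\<And>k. k \<in> {1..CARD('n)} \<Longrightarrow> 0 < ln (lam k)"
    and "mse_stable X f h K P \<xi>"
  shows "(1 - p) ^ CARD('m) * (\<Prod>k=1..CARD('n). lam k)\<^sup>2 < 1"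
proof -
  let ?J = "\<lambda>x. det (jacobian f (at x))"
  let ?D = "\<Prod>k=1..CARD('n). lam k"
  have fX: "f ` X \<subseteq> X" and hX: "h ` X \<subseteq> Y" and Cf: "Cr_near r f X" and Ch: "Cr_near r h X"
    using \<open>system_assms r X Y f h\<close> unfolding system_assms_def by blast+
  have CK: "Cr_near rK K Y"
    and obs: "\<And>s x z t. x \<in> X \<Longrightarrow> z \<in> X \<Longrightarrow> observer f h K s x z t \<in> X"
    using \<open>observer_assms rK X Y f h K\<close> unfolding observer_assms_def by blast+
  have nz: "?J x \<noteq> 0" if "x \<in> X" for x
    using \<open>system_assms r X Y f h\<close> that det_jacobian_nonzero
    unfolding system_assms_def Let_def by blast
  have f: "f differentiable (at x)" and h: "h differentiable (at x)"
    and K: "K differentiable (at (h x))" if "x \<in> X" for x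
    using that hX Cr_near_differentiable[OF Cf \<open>1 \<le> r\<close>] Cr_near_differentiable[OF Ch \<open>1 \<le> r\<close>]
      Cr_near_differentiable[OF CK \<open>1 \<le> rK\<close>] by auto
  have contf: "continuous_on X f"
    using f by (intro continuous_at_imp_continuous_on) (auto intro: differentiable_imp_continuous_within)
  have orbit: "(f ^^ k) x \<in> X" if "x \<in> X" for k x
    using that fX by (induction k) auto
  have oX: "f z + K (h x) - K (h z) \<in> X" if "x \<in> X" "z \<in> X" for x z
    using obs[OF that, of "\<lambda>_. True" "Suc 0"] by simp
  define \<phi> where "\<phi> x = ln \<bar>?J x\<bar>" for x
  have \<phi>: "continuous_on X \<phi>"
    unfolding \<phi>_def using continuous_on_det_jacobian[OF Cf \<open>1 \<le> r\<close>] nz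
    by (intro continuous_on_ln continuous_on_rabs) auto

  have inv: "invariant_measure X f \<mu>"
    using \<open>physical_measure X f \<mu>\<close> by (simp add: physical_measure_def ergodic_measure_def)
  interpret \<mu>: prob_space \<mu> using inv by (simp add: invariant_measure_def)
  have space: "space \<mu> = X"
    using inv sets_eq_imp_space_eq[of \<mu> "restrict_space borel X"]
    by (simp add: invariant_measure_def space_restrict_space)
  \<comment> \<open>As \<open>ln 0 = 0\<close> by convention, a positive logarithm rules out a zero eigenvalue.\<close>
  have "lam k \<noteq> 0" if "k \<in> {1..CARD('n)}" for k
    using assms(13)[OF that] by auto
  then have D_nz: "?D \<noteq> 0" by simp
  have good: "(\<lambda>n. (1 / real n) * (\<Sum>k=0..n. \<phi> ((f ^^ k) x))) \<longlonglongrightarrow> ln ?D \<and> 0 < ?D"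
    if x: "x \<in> X" and Lam: "lyapunov_limit f x Lam" "ordered_eigenvalues Lam lam" for x Lam
    using tendsto_ln_det_average[OF nz[OF orbit[OF x]] Lam(1)] D_nz
    by (simp add: det_ordered_eigenvalues[OF Lam(2)] \<phi>_def)
  have ae: "AE x in \<mu>. (\<lambda>n. (1 / real n) * (\<Sum>k=0..n. \<phi> ((f ^^ k) x))) \<longlonglongrightarrow> ln ?D \<and> 0 < ?D"
    using \<open>exp_lyapunov_exponents f \<mu> lam\<close> AE_space unfolding exp_lyapunov_exponents_def
    by eventually_elim (use good space in blast)
  then have D: "0 < ?D" by (auto dest: \<mu>.AE_const[THEN iffD1])
  have int: "(\<integral>x. \<phi> x \<partial>\<mu>) = ln ?D"
    by (rule integral_eq_of_birkhoff_limit[OF inv fX contf \<phi> \<open>compact X\<close>]) (use ae in auto)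

  obtain S where S: "S \<subseteq> X" "S \<in> sets lebesgue" "0 < emeasure lebesgue S"
    and basin: "\<And>x \<phi>. x \<in> S \<Longrightarrow> continuous_on X \<phi> \<Longrightarrow>
      (\<lambda>n. (1 / real n) * (\<Sum>k=0..n. \<phi> ((f ^^ k) x))) \<longlonglongrightarrow> (\<integral>x. \<phi> x \<partial>\<mu>)"
    using \<open>physical_measure X f \<mu>\<close> unfolding physical_measure_def by blast
  have p01: "0 \<le> p" "p \<le> 1" using \<open>0 < p\<close> \<open>p < 1\<close> by auto
  obtain L \<beta> where L: "0 < L" and \<beta>: "0 < \<beta>" "\<beta> < 1"
    and moment: "AE x in lborel. x \<in> X \<longrightarrow>
      (\<forall>t j. second_moment f h K p (Suc t) x (axis j 1) \<le> L * \<beta> ^ t)"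
    by (rule AE_second_moment_le[OF \<open>compact X\<close> fX oX f h K \<open>iid_bernoulli P \<xi> p\<close> p01
        \<open>mse_stable X f h K P \<xi>\<close>])
  \<comment> \<open>The measure may be singular with respect to Lebesgue measure, so the moment bound is used at a
    Lebesgue typical point of its basin, where Birkhoff averages still see the measure.\<close>
  have "\<exists>x\<in>S. \<forall>t j. second_moment f h K p (Suc t) x (axis j 1) \<le> L * \<beta> ^ t"
  proof (rule ccontr)
    assume none: "\<not> ?thesis"
    have "AE x in lborel. x \<notin> S"
      using moment by eventually_elim (use none S(1) in blast)
    then have "S \<in> null_sets lebesgue"
      using S(2) by (simp add: AE_iff_null_sets AE_completion)
    then show False using S(3) by auto
  qed
  then obtain x where xS: "x \<in> S"
    and x_moment: "\<And>t j. second_moment f h K p (Suc t) x (axis j 1) \<le> L * \<beta> ^ t" by blast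
  have x: "x \<in> X" using xS S(1) by blast

  let ?c = "sqrt (1 - p)"
  have "real CARD('m) * ln ?c + ln ?D \<le> real CARD('n) * (ln \<beta> / 2)"
  proof (rule growth_rate_le)
    show "?J ((f ^^ k) x) \<noteq> 0" for k by (rule nz[OF orbit[OF x]])
    show "(\<lambda>n. (1 / real n) * (\<Sum>k=0..n. ln \<bar>?J ((f ^^ k) x)\<bar>)) \<longlonglongrightarrow> ln ?D"
      using basin[OF xS \<phi>] unfolding int by (simp only: \<phi>_def)
    fix t
    obtain G :: "real^'n^'n" where G: "\<And>v. (norm (G *v v))\<^sup>2 = second_moment f h K p (Suc t) x v"
      and detG: "?c ^ (CARD('m) * Suc t) * (\<Prod>k<Suc t. \<bar>?J ((f ^^ k) x)\<bar>) \<le> \<bar>det G\<bar>"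
      using second_moment_gram[OF p01, of f h K "Suc t" x] by blast
    have "norm (G *v axis j 1) \<le> sqrt (L * \<beta> ^ t)" for j
      using x_moment[of t j] unfolding G[symmetric] by (rule real_le_rsqrt)
    then have "\<bar>det G\<bar> \<le> fact CARD('n) * sqrt (L * \<beta> ^ t) ^ CARD('n)"
      by (rule abs_det_le_columns)
    with detG show "?c ^ (CARD('m) * Suc t) * (\<Prod>k<Suc t. \<bar>?J ((f ^^ k) x)\<bar>)
        \<le> fact CARD('n) * sqrt (L * \<beta> ^ t) ^ CARD('n)"
      by (rule order_trans)
  qed (use \<open>p < 1\<close> L \<beta> in auto)
  also have "\<dots> < 0" using \<beta> by (simp add: mult_pos_neg)
  finally have "real CARD('m) * ln (1 - p) + 2 * ln ?D < 0"
    using \<open>p < 1\<close> by (simp add: ln_sqrt)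
  moreover have "ln ((1 - p) ^ CARD('m) * ?D\<^sup>2) = real CARD('m) * ln (1 - p) + 2 * ln ?D"
    using \<open>p < 1\<close> D_nz by (simp add: ln_mult ln_realpow del: prod_zero_iff)
  ultimately have "ln ((1 - p) ^ CARD('m) * ?D\<^sup>2) < 0" by linarith
  moreover have "0 < (1 - p) ^ CARD('m) * ?D\<^sup>2"
    using \<open>p < 1\<close> D by (intro mult_pos_pos zero_less_power) simp
  ultimately show ?thesis
    by (simp only: ln_less_zero_iff)
qed

end
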